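(* Consider the stochastic model-based algorithm of the context applied to $\psi=f+\omega$, where the samples are i.i.d., $\omega$ is $\kappa$-weakly convex and $L_\omega$-Lipschitz on $\operatorname{dom}\omega$, the model satisfies the accuracy and convexity conditions (M) of the context with parameter $\tau$, the generalized Lipschitz condition (G) holds with constant $L_f$ and growth function $\mathcal{G}$, the envelope $\psi_{1/\rho}$ is bounded below by $-\Lambda\le 0$, and its level sets have bounded diameter with bounds $\mathsf{B}_v$ as in the context. Let $\rho>\kappa+\tau$, $\alpha>0$, and run the algorithm for $K$ iterations with $$\gamma_k=\rho+\kappa+\tau+\alpha\,(\mathcal{G}(\|x^k\|)+1)\sqrt{K}.$$ Let $\Delta=\psi_{1/\rho}(x^1)+\Lambda+\frac{\rho(L_f+L_\omega)^2}{\alpha^2}>0$ and $D=\psi(x^1)-\inf_x\psi(x)$. Given $\delta\in(0,1/4)$ and $p\in(2\delta,1)$, with probability at least $1-p$, $(1-2p^{-1}\delta)K$ of the iterates lie in the ball (centered at the origin) of radius $$\mathsf{R}(\delta)=\mathsf{B}_{\delta^{-1}\Delta}+\frac{4(L_f+L_\omega)}{\alpha\sqrt{K}},$$ and $$\min_{1\le k\le K}\mathbb{E}\big[\|\nabla\psi_{1/\rho}(x^k)\|^2\big]\le\frac{p}{p-2\delta}\cdot\frac{2\rho}{\rho-\tau-\kappa}\left[D+\frac{\rho}{2\alpha^2}(L_f+L_\omega)^2\right]\left(\frac{\rho+\tau+\kappa}{K}+\frac{\alpha(\mathsf{G}_\delta+1)}{\sqrt{K}}\right),$$ where $\mathsf{G}_\delta=\max_{0\le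 z\le\mathsf{R}(\delta)}\mathcal{G}(z)$.
   Context: Problem: minimize over $x\in\mathbb{R}^n$ the function $\psi(x)=f(x)+\omega(x)$, $f(x)=\mathbb{E}_{\xi\sim\Xi}[f(x,\xi)]$, where $f(\cdot,\xi)$ is continuous and weakly convex and $\omega$ is lower semicontinuous and extended-valued. A function $g$ is $\lambda$-weakly convex ($\lambda\ge0$) if $g+\frac{\lambda}{2}\|\cdot\|^2$ is convex; it is weakly convex if this holds for some $\lambda\ge0$. $\|\cdot\|$ is the Euclidean norm. Algorithm: start from a fixed $x^1\in\operatorname{dom}\omega$; for $k=1,2,\dots$ draw $\xi^k\sim\Xi$, choose $\gamma_k>0$ and set $x^{k+1}=\arg\min_x\{f_{x^k}(x,\xi^k)+\omega(x)+\frac{\gamma_k}{2}\|x-x^k\|^2\}$, where $f_x(\cdot,\xi)$ is a stochastic model function of $f$ at $x$. Assumptions. The samples $\xi^k$ are i.i.d. $\omega$ is $\kappa$-weakly convex and $L_\omega$-Lipschitz on $\operatorname{dom}\omega$. (M) $\mathbb{E}_\xi[f_x(x,\xi)]=f(x)$ for all $x\in\operatorname{dom}\omega$; $\mathbb{E}_\xi[f_x(y,\xi)-f(y)]\le\frac{\tau}{2}\|x-y\|^2$ for all $x,y\in\operatorname{dom}\omega$; and $f_x(y,\xi)$ is convex in $y$ for all $x,y\in\operatorname{dom}\omega$, $\xi\sim\Xi$. (G) $f_x(y,\xi)-f_x(z,\xi)\le L_f(\xi)\,\mathcal{G}(\|x\|)\,\|y-z\|$ for all $x,y,z$ and $\xi\sim\Xi$,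 with $\mathbb{E}[L_f(\xi)^2]\le L_f^2$, where the growth function $\mathcal{G}:\mathbb{R}_+\to\mathbb{R}_+$ is continuous and non-decreasing. Moreau envelope: $\psi_{1/\rho}(x)=\min_z\{\psi(z)+\frac{\rho}{2}\|z-x\|^2\}$; with $\hat{x}=\arg\min_z\{\psi(z)+\frac{\rho}{2}\|z-x\|^2\}$ one has $\nabla\psi_{1/\rho}(x)=\rho(x-\hat{x})$. It is assumed that $\psi_{1/\rho}(x)\ge-\Lambda$ for all $x$, with $-\Lambda\le0$. Level sets: the $v$-level set $\mathcal{L}_v=\{x:\psi_{1/\rho}(x)\le v\}$ has bounded diameter, $\operatorname{diam}(\mathcal{L}_v)\le\mathsf{B}_v<\infty$.
   Formalization: Two corrections, as the literal claim is false: the origin is assumed to lie in the level set of Δ/δ, and the expectation is conditional on an event of probability at least 1−p on which (1−2δ/p)K of the iterates lie in the ball, not over all runs. *)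

theory Defs
  imports "HOL-Probability.Probability"
begin

definition edom :: "('a \<Rightarrow> ereal) \<Rightarrow> 'a set" where
  "edom g = {x. g x < \<infinity>}"

definition lower_semicontinuous :: "('a::topological_space \<Rightarrow> ereal) \<Rightarrow> bool" where
  "lower_semicontinuous g \<longleftrightarrow> (\<forall>x. g x \<le> Liminf (at x) g)"

text \<open>
  For a function that never takes the value \<open>-\<infinity>\<close>, convexity in the extended-valued
  sense of \<open>g + (l/2) \<parallel>\<cdot>\<parallel>\<^sup>2\<close> means that its domain is convex and that the convexity
  inequality holds there; \<^const>\<open>convex_on\<close> includes convexity of the set.
\<close>

definition weakly_convex :: "real \<Rightarrow> ('a::real_normed_vector \<Rightarrow> ereal) \<Rightarrow> bool" where
  "weakly_convex l g \<longleftrightarrow>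
     0 \<le> l \<and> convex_on (edom g) (\<lambda>x. real_of_ereal (g x) + l / 2 * (norm x)\<^sup>2)"

definition moreau_envelope ::
    "real \<Rightarrow> ('a::real_normed_vector \<Rightarrow> ereal) \<Rightarrow> 'a \<Rightarrow> ereal" where
  "moreau_envelope \<rho> g x = (INF z. g z + ereal (\<rho> / 2 * (norm (z - x))\<^sup>2))"

text \<open>Meaningful only at points where the gradient exists.\<close>

definition gradient :: "('a::real_inner \<Rightarrow> real) \<Rightarrow> 'a \<Rightarrow> 'a" where
  "gradient g x = (THE D. GDERIV g x :> D)"

definition level_set :: "('a \<Rightarrow> ereal) \<Rightarrow> real \<Rightarrow> 'a set" where
  "level_set g v = {x. g x \<le> ereal v}"

text \<open>
  Condition (M): \<open>model x y s\<close> is the value \<open>f\<^sub>x(y,s)\<close> of the model with centre \<open>x\<close>.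
  Integrability is required because the Bochner integral of a non-integrable function is 0.
\<close>

definition model_accuracy ::
    "'s measure \<Rightarrow> ('a::real_normed_vector) set \<Rightarrow> ('a \<Rightarrow> real) \<Rightarrow> ('a \<Rightarrow> 'a \<Rightarrow> 's \<Rightarrow> real) \<Rightarrow> real \<Rightarrow> bool"
  where
  "model_accuracy \<Xi> X f model \<tau> \<longleftrightarrow>
     (\<forall>x\<in>X. \<forall>y\<in>X. integrable \<Xi> (model x y)) \<and>
     (\<forall>x\<in>X. (\<integral>s. model x x s \<partial>\<Xi>) = f x) \<and>
     (\<forall>x\<in>X. \<forall>y\<in>X. (\<integral>s. model x y s - f y \<partial>\<Xi>) \<le> \<tau> / 2 * (norm (x - y))\<^sup>2) \<and>
     (\<forall>x\<in>X. \<forall>s\<in>space \<Xi>. convex_on X (\<lambda>y. model x y s))"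

text \<open>Condition (G).\<close>

definition generalized_lipschitz ::
    "'s measure \<Rightarrow> ('a::real_normed_vector \<Rightarrow> 'a \<Rightarrow> 's \<Rightarrow> real) \<Rightarrow> ('s \<Rightarrow> real) \<Rightarrow> real \<Rightarrow> (real \<Rightarrow> real) \<Rightarrow> bool"
  where
  "generalized_lipschitz \<Xi> model Lip L G \<longleftrightarrow>
     (\<forall>s\<in>space \<Xi>. \<forall>x y z. model x y s - model x z s \<le> Lip s * G (norm x) * norm (y - z)) \<and>
     Lip \<in> borel_measurable \<Xi> \<and> integrable \<Xi> (\<lambda>s. (Lip s)\<^sup>2) \<and>
     0 \<le> L \<and> (\<integral>s. (Lip s)\<^sup>2 \<partial>\<Xi>) \<le> L\<^sup>2 \<and>
     (\<forall>z\<ge>0. 0 \<le> G z) \<and> continuous_on {0..} G \<and> mono_on {0..} G"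

text \<open>
  \<open>x k\<close> is the random iterate \<open>x\<^sup>k\<close>, for \<open>1 \<le> k \<le> K + 1\<close>, with prox parameter \<open>\<gamma> (x k)\<close>
  in step \<open>k\<close>; the samples are \<open>\<xi> 1, \<dots>, \<xi> K\<close>.
\<close>

definition model_based_run ::
    "'w measure \<Rightarrow> (nat \<Rightarrow> 'w \<Rightarrow> 's) \<Rightarrow> ('a::real_normed_vector \<Rightarrow> 'a \<Rightarrow> 's \<Rightarrow> real) \<Rightarrow> ('a \<Rightarrow> ereal) \<Rightarrow>
     ('a \<Rightarrow> real) \<Rightarrow> nat \<Rightarrow> 'a \<Rightarrow> (nat \<Rightarrow> 'w \<Rightarrow> 'a) \<Rightarrow> bool"
  where
  "model_based_run M \<xi> model \<omega> \<gamma> K x1 x \<longleftrightarrow>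
     (\<forall>w\<in>space M. x 1 w = x1 \<and>
       (\<forall>k\<in>{1..K}.
          is_arg_min
            (\<lambda>y. ereal (model (x k w) y (\<xi> k w)) + \<omega> y
                 + ereal (\<gamma> (x k w) / 2 * (norm (y - x k w))\<^sup>2))
            (\<lambda>_. True) (x (Suc k) w)))"

end

theory Submission
  imports Defs
begin

text \<open>
  Averaging the models shows that \<open>f\<close> is \<open>\<tau>\<close>-weakly convex on \<open>dom \<omega>\<close>, so for \<open>\<rho> > \<kappa> + \<tau>\<close> the proximal
  point is unique and the envelope is differentiable with gradient \<open>\<rho> (x - prox x)\<close>.  Comparing the
  step with the proximal point gives the descent estimate
  \<open>E env(x\<^sup>k\<^sup>+\<^sup>1) + (\<rho> - \<tau> - \<kappa>) / (\<rho> (\<gamma>\<^sub>k - \<kappa>)) * \<parallel>grad env(x\<^sup>k)\<parallel>\<^sup>2 \<le> env(x\<^sup>k) + \<epsilon> / K\<close>, where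
  \<open>\<epsilon> = \<rho> (L\<^sub>f + L\<^sub>\<omega>)\<^sup>2 / (2 \<alpha>\<^sup>2)\<close>: the growth factor in \<open>\<gamma>\<^sub>k\<close> cancels the growth of the noise.
  Hence \<open>env(x\<^sup>k) + \<Lambda> + \<epsilon> (K + 1 - k) / K\<close> is a nonnegative supermartingale, and the maximal inequality
  keeps the whole run inside the level set of \<open>\<Delta> / \<delta>\<close> with probability at least \<open>1 - \<delta>\<close>, which is
  stronger than the claim about most of the iterates.  On that event every \<open>\<gamma>\<^sub>k\<close> is bounded through
  \<open>G\<^sub>\<delta>\<close>, and summing the descent estimate up to the exit time, then dividing by the probability of the
  event (at least one half), bounds the average of the conditional expectations.
\<close>

section \<open>Strongly convex functions\<close>

lemma norm_sq_convex_combination: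
  fixes x y :: "'a::real_inner"
  shows "(norm ((1 - t) *\<^sub>R x + t *\<^sub>R y))\<^sup>2
    = (1 - t) * (norm x)\<^sup>2 + t * (norm y)\<^sup>2 - t * (1 - t) * (norm (x - y))\<^sup>2"
  by (simp add: power2_norm_eq_inner algebra_simps inner_commute)

text \<open>Strong convexity with modulus \<open>m\<close> is written throughout as convexity of
  \<open>h\<close> minus \<open>m / 2\<close> times the squared norm, so that moduli of weak and
  strong convexity simply add.\<close>

lemma strongly_convex_onD:
  fixes h :: "'a::real_inner \<Rightarrow> real"
  assumes "convex_on X (\<lambda>y. h y - m / 2 * (norm y)\<^sup>2)" "x \<in> X" "y \<in> X" "0 \<le> t" "t \<le> 1"
  shows "h ((1 - t) *\<^sub>R x + t *\<^sub>R y)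
    \<le> (1 - t) * h x + t * h y - m / 2 * t * (1 - t) * (norm (x - y))\<^sup>2"
proof -
  have eq: "m / 2 * ((1 - t) * a + t * b - t * (1 - t) * c)
    = (1 - t) * (m / 2 * a) + t * (m / 2 * b) - m / 2 * t * (1 - t) * c" for a b c :: real
    by (simp add: field_simps)
  show ?thesis
    using convex_onD[OF assms(1) assms(4,5) assms(2,3)]
    unfolding norm_sq_convex_combination eq by (simp only: right_diff_distrib)
qed

text \<open>Compare \<open>x\<close> with the point a fraction \<open>t\<close> of the way to
  \<open>y\<close>. Minimality and strong convexity give the bound with an extra factor
  \<open>1 - t\<close> once \<open>t\<close> is cancelled; then \<open>t\<close> tends to 0.\<close>

lemma strongly_convex_on_growth:
  fixes h :: "'a::real_inner \<Rightarrow> real"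
  assumes "convex_on X (\<lambda>y. h y - m / 2 * (norm y)\<^sup>2)"
    and "x \<in> X" "\<forall>y\<in>X. h x \<le> h y" "y \<in> X"
  shows "h x + m / 2 * (norm (y - x))\<^sup>2 \<le> h y"
proof -
  let ?q = "m / 2 * (norm (x - y))\<^sup>2"
  have *: "(1 - t) * ?q \<le> h y - h x" if "0 < t" "t < 1" for t
  proof -
    have "(1 - t) *\<^sub>R x + t *\<^sub>R y \<in> X"
      using assms that convexD_alt[of X x y t] by (auto simp: convex_on_def)
    then have "h x \<le> (1 - t) * h x + t * h y - m / 2 * t * (1 - t) * (norm (x - y))\<^sup>2"
      using strongly_convex_onD[OF assms(1,2,4), of t] assms(3) that by force
    then have "t * ((1 - t) * ?q) \<le> t * (h y - h x)" by (simp add: algebra_simps)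
    then show ?thesis using that by (simp add: mult_le_cancel_left)
  qed
  have "((\<lambda>t. (1 - t) * ?q) \<longlongrightarrow> (1 - 0) * ?q) (at_right 0)"
    by (intro tendsto_intros)
  moreover have "\<forall>\<^sub>F t in at_right 0. (1 - t) * ?q \<le> h y - h x"
    using eventually_at_right[of 0 "1::real"] * by (auto simp: eventually_at_right[of 0 "1::real"] intro!: exI[of _ 1])
  ultimately have "(1 - 0) * ?q \<le> h y - h x"
    by (intro tendsto_upperbound) auto
  then show ?thesis by (simp add: norm_minus_commute)
qed

text \<open>The midpoint of \<open>z\<close> and any \<open>y\<close> with
  \<open>h y \<le> h z\<close> still has value at least \<open>b\<close>. The quadratic gain at the
  midpoint, with coefficient \<open>m / 8\<close>, therefore bounds the distance from
  \<open>z\<close> to \<open>y\<close>, and the sublevel set is compact.\<close>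

lemma strongly_convex_on_minimizer:
  fixes h :: "'a::euclidean_space \<Rightarrow> real"
  assumes conv: "convex_on X (\<lambda>y. h y - m / 2 * (norm y)\<^sup>2)" and "0 < m"
    and "closed X" "X \<noteq> {}" "continuous_on X h" and b: "\<forall>y\<in>X. b \<le> h y"
  shows "\<exists>x\<in>X. \<forall>y\<in>X. h x \<le> h y"
proof -
  obtain z where z: "z \<in> X" using assms by auto
  let ?S = "{y\<in>X. h y \<le> h z}"
  have "closed ?S"
    using continuous_closed_preimage[OF assms(5,3), of "{..h z}"]
    by (simp add: vimage_def Int_def conj_commute)
  moreover have "(norm (z - y))\<^sup>2 \<le> 8 / m * (h z - b)" if y: "y \<in> ?S" for y
  proof -
    have "(1 - 1/2) *\<^sub>R z + (1/2) *\<^sub>R y \<in> X"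
      using y z conv convexD_alt[of X z y "1/2"] by (auto simp: convex_on_def)
    then have "b \<le> h ((1 - 1/2) *\<^sub>R z + (1/2) *\<^sub>R y)" using b by blast
    also have "\<dots> \<le> (1 - 1/2) * h z + 1/2 * h y - m / 2 * (1/2) * (1 - 1/2) * (norm (z - y))\<^sup>2"
      using strongly_convex_onD[OF conv z, of y "1/2"] y by simp
    finally have "m * (norm (z - y))\<^sup>2 \<le> 8 * (h z - b)" using y by simp
    then show ?thesis using \<open>0 < m\<close> by (simp add: field_simps)
  qed
  then have "norm (z - y) \<le> sqrt (8 / m * (h z - b))" if "y \<in> ?S" for y
    using that real_le_rsqrt by blast
  then have "bounded ?S"
    by (intro bounded_subset[OF bounded_cball[of z]]) (auto simp: dist_norm subset_iff)
  ultimately have "compact ?S" by (simp add: compact_eq_bounded_closed)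
  moreover have "continuous_on ?S h" using assms(5) by (rule continuous_on_subset) auto
  ultimately obtain x where "x \<in> ?S" "\<forall>y\<in>?S. h x \<le> h y"
    using continuous_attains_inf[of ?S h] z by auto
  then have "\<forall>y\<in>X. h x \<le> h y" using linear by force
  then show ?thesis using \<open>x \<in> ?S\<close> by auto
qed

lemma convex_on_affine_inner:
  "convex X \<Longrightarrow> convex_on X (\<lambda>y::'a::real_inner. a + c \<bullet> y)"
  unfolding convex_on_def
  by (auto simp: inner_add_right algebra_simps) (metis distrib_left mult.commute mult.right_neutral order_refl)

text \<open>Apart from its \<open>g / 2 * (norm y)\<^sup>2\<close>, the prox term is affine in
  \<open>y\<close>, so it outweighs weak convexity \<open>l\<close> and leaves modulus
  \<open>g - l\<close>. This serves the proximal problem (\<rho> against \<tau> + \<kappa>) and the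
  algorithmic step (\<open>\<gamma> c\<close> against \<kappa>).\<close>

lemma convex_on_add_prox:
  fixes h :: "'a::real_inner \<Rightarrow> real"
  assumes "convex_on X (\<lambda>y. h y + l / 2 * (norm y)\<^sup>2)"
  shows "convex_on X (\<lambda>y. (h y + g / 2 * (norm (y - c))\<^sup>2) - (g - l) / 2 * (norm y)\<^sup>2)"
proof -
  have "convex_on X (\<lambda>y. (h y + l / 2 * (norm y)\<^sup>2) + (g / 2 * (norm c)\<^sup>2 + (- g *\<^sub>R c) \<bullet> y))"
    using assms by (intro convex_on_add assms convex_on_affine_inner) (simp add: convex_on_def)
  moreover have "(\<lambda>y. (h y + l / 2 * (norm y)\<^sup>2) + (g / 2 * (norm c)\<^sup>2 + (- g *\<^sub>R c) \<bullet> y))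
    = (\<lambda>y. (h y + g / 2 * (norm (y - c))\<^sup>2) - (g - l) / 2 * (norm y)\<^sup>2)"
    by (rule ext) (simp add: power2_norm_eq_inner inner_commute field_simps inner_diff_left inner_diff_right)
  ultimately show ?thesis by simp
qed

lemma dense_sequence_in:
  fixes X :: "'a::euclidean_space set"
  assumes "X \<noteq> {}"
  obtains d :: "nat \<Rightarrow> 'a" where "range d \<subseteq> X" "X \<subseteq> closure (range d)"
proof -
  obtain T where T: "countable T" "T \<subseteq> X" "X \<subseteq> closure T"
    using separable[of X] by blast
  then have "T \<noteq> {}" using assms by auto
  with T show ?thesis by (intro that[of "from_nat_into T"]) (auto simp: range_from_nat_into)
qed

text \<open>Completing the square. Later \<open>a\<close> is a Lipschitz constant and
  \<open>g\<close> a prox weight, and the right-hand side is the noise of one step.\<close>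

lemma linear_minus_quadratic_le:
  fixes a d g :: real
  assumes "0 < g"
  shows "a * d - g / 2 * d\<^sup>2 \<le> a\<^sup>2 / (2 * g)"
proof -
  have "0 \<le> (a - g * d)\<^sup>2 / (2 * g)" using assms by simp
  also have "\<dots> = a\<^sup>2 / (2 * g) - (a * d - g / 2 * d\<^sup>2)"
    using assms by (simp add: power2_eq_square field_simps)
  finally show ?thesis by simp
qed

text \<open>A minimizer picked by choice is not evidently measurable. Along a countable dense
  sequence the minimal value becomes a countable infimum, and near-minimizers of least index are
  measurable; the growth condition makes them converge to \<open>P w\<close>.\<close>

lemma borel_measurable_strongly_convex_argmin:
  fixes h :: "'b \<Rightarrow> 'a::euclidean_space \<Rightarrow> real"
  assumes X: "X \<noteq> {}"
    and meas: "\<And>y. y \<in> X \<Longrightarrow> (\<lambda>w. h w y) \<in> borel_measurable N"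
    and cont: "\<And>w. w \<in> space N \<Longrightarrow> continuous_on X (h w)"
    and P: "\<And>w. w \<in> space N \<Longrightarrow> P w \<in> X"
    and \<mu>: "\<And>w. w \<in> space N \<Longrightarrow> 0 < \<mu> w"
    and growth: "\<And>w y. w \<in> space N \<Longrightarrow> y \<in> X \<Longrightarrow> h w (P w) + \<mu> w / 2 * (norm (y - P w))\<^sup>2 \<le> h w y"
  shows "P \<in> borel_measurable N"
proof -
  obtain d :: "nat \<Rightarrow> 'a" where d: "range d \<subseteq> X" "X \<subseteq> closure (range d)"
    using dense_sequence_in[OF X] .
  have dX: "d j \<in> X" for j using d by auto
  have [measurable]: "(\<lambda>w. h w (d j)) \<in> borel_measurable N" for j
    using meas dX by blast
  have min: "h w (P w) \<le> h w y" if "w \<in> space N" "y \<in> X" for w y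
    using growth[OF that] \<mu>[OF that(1)] by (smt (verit) mult_nonneg_nonneg zero_le_power2 half_gt_zero)
  have approx: "\<exists>j. h w (d j) < h w (P w) + e" if w: "w \<in> space N" and "0 < e" for w e
  proof -
    have "P w \<in> closure (range d)" using P[OF w] d by auto
    then obtain y where y: "\<And>n. y n \<in> range d" "y \<longlonglongrightarrow> P w"
      unfolding closure_sequential by auto
    have "(\<lambda>n. h w (y n)) \<longlonglongrightarrow> h w (P w)"
      using y P[OF w] d
      by (intro continuous_on_tendsto_compose[OF cont[OF w]]) (auto intro!: always_eventually)
    then have "\<forall>\<^sub>F n in sequentially. h w (y n) < h w (P w) + e"
      using \<open>0 < e\<close> by (intro order_tendstoD(2)) auto
    then obtain n where "h w (y n) < h w (P w) + e"
      using eventually_happens by force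
    then show ?thesis using y(1)[of n] by auto
  qed
  define v where "v w = (INF j. h w (d j))" for w
  have v: "v w = h w (P w)" if w: "w \<in> space N" for w
  proof (rule antisym)
    show "h w (P w) \<le> v w"
      unfolding v_def using min[OF w dX] by (intro cINF_greatest) auto
    show "v w \<le> h w (P w)"
    proof (rule field_le_epsilon)
      fix e :: real assume "0 < e"
      then obtain j where "h w (d j) < h w (P w) + e" using approx[OF w] by auto
      moreover have "v w \<le> h w (d j)"
        unfolding v_def using min[OF w dX] by (intro cINF_lower bdd_belowI2) auto
      ultimately show "v w \<le> h w (P w) + e" by linarith
    qed
  qed
  have [measurable]: "v \<in> borel_measurable N"
    unfolding v_def[abs_def]
    using min dX by (intro borel_measurable_cINF) (auto intro!: bdd_belowI2)
  define u where "u n w = d (LEAST j. h w (d j) < v w + 1 / (real n + 1))" for n w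
  have u_meas: "u n \<in> borel_measurable N" for n
    unfolding u_def[abs_def] by (rule measurable_compose_countable) auto
  show ?thesis
  proof (rule borel_measurable_LIMSEQ_metric[OF u_meas])
    fix w assume w: "w \<in> space N"
    have bound: "dist (u n w) (P w) \<le> sqrt (2 / \<mu> w * (1 / (real n + 1)))" for n
    proof -
      have "h w (u n w) < v w + 1 / (real n + 1)"
        unfolding u_def v[OF w]
        by (rule LeastI_ex) (use approx[OF w, of "1 / (real n + 1)"] in auto)
      then have "\<mu> w / 2 * (norm (u n w - P w))\<^sup>2 \<le> 1 / (real n + 1)"
        using growth[OF w, of "u n w"] dX v[OF w] by (auto simp: u_def)
      moreover have "N \<le> 2 / \<mu> w * r" if "\<mu> w / 2 * N \<le> r" for N r
        using that \<mu>[OF w] by (simp add: field_simps)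
      ultimately have "(norm (u n w - P w))\<^sup>2 \<le> 2 / \<mu> w * (1 / (real n + 1))" by blast
      then show ?thesis by (simp add: dist_norm real_le_rsqrt)
    qed
    have "(\<lambda>n. 1 / (real n + 1)) \<longlonglongrightarrow> 0"
      using LIMSEQ_inverse_real_of_nat by (simp add: inverse_eq_divide add.commute)
    then have "(\<lambda>n. sqrt (2 / \<mu> w * (1 / (real n + 1)))) \<longlonglongrightarrow> sqrt (2 / \<mu> w * 0)"
      by (intro tendsto_intros)
    then have lim: "(\<lambda>n. sqrt (2 / \<mu> w * (1 / (real n + 1)))) \<longlonglongrightarrow> 0"
      by (simp only: mult_zero_right real_sqrt_zero)
    have "(\<lambda>n. dist (u n w) (P w)) \<longlonglongrightarrow> 0"
      by (rule Lim_null_comparison[OF always_eventually lim]) (use bound in simp)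
    then show "(\<lambda>n. u n w) \<longlonglongrightarrow> P w"
      by (subst tendsto_dist_iff)
  qed
qed

section \<open>The Moreau envelope\<close>

text \<open>The extended-valued \<omega> enters through its domain \<open>X\<close> and its real
  values there. The lower bound \<open>m\<close> stays a parameter because two values are used in
  the end: minus \<Lambda> for the exit probability and the infimum of \<psi> for the descent
  sum.\<close>

locale weakly_convex_model = prob_space \<Xi> for \<Xi> :: "'s measure" +
  fixes X :: "'a::euclidean_space set" and f \<omega> :: "'a \<Rightarrow> real"
    and model :: "'a \<Rightarrow> 'a \<Rightarrow> 's \<Rightarrow> real" and Lip :: "'s \<Rightarrow> real" and G :: "real \<Rightarrow> real"
    and L\<^sub>f L\<^sub>\<omega> \<kappa> \<tau> \<rho> m :: real
  assumes closed_X: "closed X" and X_nonempty: "X \<noteq> {}"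
    and \<kappa>_nonneg: "0 \<le> \<kappa>" and \<omega>_convex: "convex_on X (\<lambda>y. \<omega> y + \<kappa> / 2 * (norm y)\<^sup>2)"
    and \<omega>_lipschitz: "lipschitz_on L\<^sub>\<omega> X \<omega>"
    and \<tau>_nonneg: "0 \<le> \<tau>" and accuracy: "model_accuracy \<Xi> X f model \<tau>"
    and lipschitz: "generalized_lipschitz \<Xi> model Lip L\<^sub>f G"
    and \<rho>_gt: "\<kappa> + \<tau> < \<rho>"
    and lower: "\<And>y. y \<in> X \<Longrightarrow> m \<le> f y + \<omega> y"
begin

lemma convex_X: "convex X"
  using \<omega>_convex by (simp add: convex_on_def)

lemma L\<^sub>\<omega>_nonneg: "0 \<le> L\<^sub>\<omega>"
  using \<omega>_lipschitz by (simp add: lipschitz_on_def)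

lemma L\<^sub>f_nonneg: "0 \<le> L\<^sub>f"
  using lipschitz by (simp add: generalized_lipschitz_def)

lemma G_nonneg: "0 \<le> G (norm c)"
  using lipschitz by (simp add: generalized_lipschitz_def)

lemma G_mono: "0 \<le> a \<Longrightarrow> a \<le> b \<Longrightarrow> G a \<le> G b"
  using lipschitz by (auto simp: generalized_lipschitz_def mono_on_def)

lemma \<omega>_lip: "x \<in> X \<Longrightarrow> y \<in> X \<Longrightarrow> \<omega> x - \<omega> y \<le> L\<^sub>\<omega> * norm (x - y)"
  using \<omega>_lipschitz by (fastforce simp: lipschitz_on_def dist_norm)

lemma model_lip:
  "s \<in> space \<Xi> \<Longrightarrow> model c y s - model c z s \<le> Lip s * G (norm c) * norm (y - z)"
  using lipschitz by (auto simp: generalized_lipschitz_def)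

lemma integrable_model: "x \<in> X \<Longrightarrow> y \<in> X \<Longrightarrow> integrable \<Xi> (model x y)"
  using accuracy by (auto simp: model_accuracy_def)

lemma integral_model_center: "x \<in> X \<Longrightarrow> (\<integral>s. model x x s \<partial>\<Xi>) = f x"
  using accuracy by (auto simp: model_accuracy_def)

lemma integral_model_le:
  assumes "x \<in> X" "y \<in> X"
  shows "(\<integral>s. model x y s \<partial>\<Xi>) \<le> f y + \<tau> / 2 * (norm (x - y))\<^sup>2"
proof -
  have "(\<integral>s. model x y s - f y \<partial>\<Xi>) \<le> \<tau> / 2 * (norm (x - y))\<^sup>2"
    using accuracy assms by (auto simp: model_accuracy_def)
  then show ?thesis using integrable_model[OF assms] by (simp add: prob_space)
qed

lemma model_convex: "x \<in> X \<Longrightarrow> s \<in> space \<Xi> \<Longrightarrow> convex_on X (\<lambda>y. model x y s)"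
  using accuracy by (auto simp: model_accuracy_def)

section \<open>Moments of the random Lipschitz constant\<close>

lemma Lip_square_integrable: "integrable \<Xi> (\<lambda>s. (Lip s)\<^sup>2)"
  and Lip_measurable: "Lip \<in> borel_measurable \<Xi>"
  and integral_Lip_square_le: "(\<integral>s. (Lip s)\<^sup>2 \<partial>\<Xi>) \<le> L\<^sub>f\<^sup>2"
  using lipschitz by (auto simp: generalized_lipschitz_def)

lemma Lip_integrable: "integrable \<Xi> Lip"
  using Lip_measurable Lip_square_integrable by (rule square_integrable_imp_integrable)

text \<open>Nonnegativity of the variance turns the second-moment bound into a first-moment
  bound.\<close>

lemma integral_Lip_le: "(\<integral>s. Lip s \<partial>\<Xi>) \<le> L\<^sub>f"
proof -
  have "0 \<le> variance Lip" by simp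
  then have "(\<integral>s. Lip s \<partial>\<Xi>)\<^sup>2 \<le> L\<^sub>f\<^sup>2"
    using variance_eq[OF Lip_integrable Lip_square_integrable] integral_Lip_square_le by linarith
  then show ?thesis using L\<^sub>f_nonneg power2_le_imp_le by blast
qed

text \<open>Bounding the first and second moments of \<open>Lip\<close> separately costs nothing
  here: the two bounds recombine to a perfect square.\<close>

lemma integral_Lip_affine_square_le:
  assumes "0 \<le> g"
  shows "integrable \<Xi> (\<lambda>s. (Lip s * g + L\<^sub>\<omega>)\<^sup>2)"
    and "(\<integral>s. (Lip s * g + L\<^sub>\<omega>)\<^sup>2 \<partial>\<Xi>) \<le> (L\<^sub>f * g + L\<^sub>\<omega>)\<^sup>2"
proof -
  have eq: "(\<lambda>s. (Lip s * g + L\<^sub>\<omega>)\<^sup>2) = (\<lambda>s. g\<^sup>2 * (Lip s)\<^sup>2 + 2 * g * L\<^sub>\<omega> * Lip s + L\<^sub>\<omega>\<^sup>2)"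
    by (auto simp: power2_eq_square algebra_simps)
  show "integrable \<Xi> (\<lambda>s. (Lip s * g + L\<^sub>\<omega>)\<^sup>2)"
    unfolding eq using Lip_integrable Lip_square_integrable by simp
  have "(\<integral>s. (Lip s * g + L\<^sub>\<omega>)\<^sup>2 \<partial>\<Xi>)
    = g\<^sup>2 * (\<integral>s. (Lip s)\<^sup>2 \<partial>\<Xi>) + 2 * g * L\<^sub>\<omega> * (\<integral>s. Lip s \<partial>\<Xi>) + L\<^sub>\<omega>\<^sup>2"
    unfolding eq using Lip_integrable Lip_square_integrable by (simp add: prob_space)
  also have "\<dots> \<le> g\<^sup>2 * L\<^sub>f\<^sup>2 + 2 * g * L\<^sub>\<omega> * L\<^sub>f + L\<^sub>\<omega>\<^sup>2"
    using integral_Lip_square_le integral_Lip_le assms L\<^sub>\<omega>_nonneg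
    by (intro add_mono mult_left_mono) auto
  finally show "(\<integral>s. (Lip s * g + L\<^sub>\<omega>)\<^sup>2 \<partial>\<Xi>) \<le> (L\<^sub>f * g + L\<^sub>\<omega>)\<^sup>2"
    by (simp add: power2_eq_square algebra_simps)
qed

text \<open>Averaging the convex models centred at the convex combination \<open>z\<close> gives a convex function
  that agrees with \<open>f\<close> at \<open>z\<close> and lies below \<open>f\<close> up to the quadratic error.\<close>

lemma f_weakly_convex: "convex_on X (\<lambda>y. f y + \<tau> / 2 * (norm y)\<^sup>2)"
proof (rule convex_onI)
  fix t :: real and x y assume t: "0 < t" "t < 1" and xy: "x \<in> X" "y \<in> X"
  define z where "z = (1 - t) *\<^sub>R x + t *\<^sub>R y"
  have z: "z \<in> X"
    using convexD_alt[OF convex_X xy, of t] t by (simp add: z_def)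
  have "f z = (\<integral>s. model z z s \<partial>\<Xi>)" using integral_model_center[OF z] by simp
  also have "\<dots> \<le> (\<integral>s. (1 - t) * model z x s + t * model z y s \<partial>\<Xi>)"
    using t xy z integrable_model model_convex
    by (intro integral_mono) (auto simp: z_def intro!: convex_onD)
  also have "\<dots> = (1 - t) * (\<integral>s. model z x s \<partial>\<Xi>) + t * (\<integral>s. model z y s \<partial>\<Xi>)"
    using xy z integrable_model by simp
  also have "\<dots> \<le> (1 - t) * (f x + \<tau> / 2 * (norm (z - x))\<^sup>2) + t * (f y + \<tau> / 2 * (norm (z - y))\<^sup>2)"
    using t xy z integral_model_le by (intro add_mono mult_left_mono) auto
  finally have 1: "f z \<le> \<dots>" .
  have "z - x = t *\<^sub>R (y - x)" "z - y = (1 - t) *\<^sub>R (x - y)"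
    by (auto simp: z_def algebra_simps)
  then have 2: "(norm (z - x))\<^sup>2 = t\<^sup>2 * (norm (x - y))\<^sup>2" "(norm (z - y))\<^sup>2 = (1 - t)\<^sup>2 * (norm (x - y))\<^sup>2"
    by (simp_all add: power_mult_distrib norm_minus_commute)
  show "f ((1 - t) *\<^sub>R x + t *\<^sub>R y) + \<tau> / 2 * (norm ((1 - t) *\<^sub>R x + t *\<^sub>R y))\<^sup>2
      \<le> (1 - t) * (f x + \<tau> / 2 * (norm x)\<^sup>2) + t * (f y + \<tau> / 2 * (norm y)\<^sup>2)"
  proof -
    let ?N = "(norm (x - y))\<^sup>2"
    \<comment> \<open>The two accuracy errors sum to exactly the defect in the identity for the
      squared norm of a convex combination, so the added \<open>\<tau> / 2\<close> term absorbs
      them.\<close>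
    have "(1 - t) * (f x + \<tau> / 2 * (t\<^sup>2 * ?N)) + t * (f y + \<tau> / 2 * ((1 - t)\<^sup>2 * ?N))
      = (1 - t) * f x + t * f y + \<tau> / 2 * (t * (1 - t) * ?N)"
      by (simp add: field_simps power2_eq_square)
    note 1[unfolded 2 this]
    moreover have "\<tau> / 2 * (norm z)\<^sup>2
      = (1 - t) * (\<tau> / 2 * (norm x)\<^sup>2) + t * (\<tau> / 2 * (norm y)\<^sup>2) - \<tau> / 2 * (t * (1 - t) * ?N)"
      unfolding z_def norm_sq_convex_combination by (simp add: field_simps)
    ultimately show ?thesis
      unfolding z_def[symmetric] distrib_left by linarith
  qed
qed (rule convex_X)

text \<open>On average the model centred at \<open>z\<close> is exact at \<open>z\<close> and
  exceeds \<open>f y\<close> by at most the quadratic error, so its Lipschitz bound passes to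
  \<open>f\<close>. The growth factor sits at the centre \<open>z\<close>; continuity uses the bound
  in both orders.\<close>

lemma f_lip:
  assumes "z \<in> X" "y \<in> X"
  shows "f z - f y \<le> L\<^sub>f * G (norm z) * norm (z - y) + \<tau> / 2 * (norm (z - y))\<^sup>2"
proof -
  have "(\<integral>s. model z z s \<partial>\<Xi>) - (\<integral>s. model z y s \<partial>\<Xi>)
    = (\<integral>s. model z z s - model z y s \<partial>\<Xi>)"
    using assms integrable_model by simp
  also have "\<dots> \<le> (\<integral>s. Lip s * (G (norm z) * norm (z - y)) \<partial>\<Xi>)"
    using assms integrable_model Lip_integrable model_lip[of _ z z y]
    by (intro integral_mono) (auto simp: mult.assoc)
  also have "\<dots> = (\<integral>s. Lip s \<partial>\<Xi>) * (G (norm z) * norm (z - y))" by simp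
  also have "\<dots> \<le> L\<^sub>f * (G (norm z) * norm (z - y))"
    using integral_Lip_le by (intro mult_right_mono) (auto intro!: mult_nonneg_nonneg G_nonneg)
  finally show ?thesis
    using integral_model_le[OF assms] integral_model_center[OF assms(1)] by (simp add: mult.assoc)
qed

lemma f_continuous: "continuous_on X f"
  unfolding continuous_on_def
proof
  fix z assume z: "z \<in> X"
  \<comment> \<open>Within distance 1 of \<open>z\<close> the growth factors at \<open>z\<close> and
    at \<open>y\<close> are both at most \<open>G (norm z + 1)\<close>.\<close>
  define C where "C = L\<^sub>f * G (norm z + 1)"
  define b where "b y = C * norm (y - z) + \<tau> / 2 * (norm (y - z))\<^sup>2" for y
  have "\<forall>\<^sub>F y in at z within X. norm (f y - f z) \<le> b y"
    unfolding eventually_at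
  proof (intro exI[of _ 1] conjI ballI impI)
    fix y assume y: "y \<in> X" "y \<noteq> z \<and> dist y z < 1"
    have "norm y \<le> norm z + 1" using norm_triangle_sub[of y z] y by (simp add: dist_norm)
    then have "L\<^sub>f * G (norm y) * norm (y - z) \<le> C * norm (y - z)" "L\<^sub>f * G (norm z) * norm (y - z) \<le> C * norm (y - z)"
      unfolding C_def using L\<^sub>f_nonneg by (auto intro!: mult_right_mono mult_left_mono G_mono)
    then show "norm (f y - f z) \<le> b y"
      using f_lip[OF z y(1)] f_lip[OF y(1) z] by (auto simp: b_def norm_minus_commute)
  qed simp
  moreover have "continuous (at z within X) b"
    unfolding b_def[abs_def] by (intro continuous_intros)
  then have "(b \<longlongrightarrow> 0) (at z within X)" by (simp add: continuous_within b_def)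
  ultimately have "((\<lambda>y. f y - f z) \<longlongrightarrow> 0) (at z within X)"
    by (rule Lim_null_comparison)
  then show "(f \<longlongrightarrow> f z) (at z within X)" by (simp add: LIM_zero_iff)
qed

lemma \<omega>_continuous: "continuous_on X \<omega>"
  using \<omega>_lipschitz by (rule lipschitz_on_continuous_on)

section \<open>Proximal points: existence, growth and Lipschitz dependence on the centre\<close>

definition prox_objective :: "'a \<Rightarrow> 'a \<Rightarrow> real" where
  "prox_objective c z = f z + \<omega> z + \<rho> / 2 * (norm (z - c))\<^sup>2"

definition proximal_point :: "'a \<Rightarrow> 'a" where
  "proximal_point c = (SOME z. z \<in> X \<and> (\<forall>y\<in>X. prox_objective c z \<le> prox_objective c y))"

text \<open>The real-valued counterpart of \<open>moreau_envelope\<close>;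
  \<open>moreau_envelope_eq\<close> identifies the two.\<close>

definition envelope :: "'a \<Rightarrow> real" where
  "envelope c = prox_objective c (proximal_point c)"

lemma prox_objective_convex:
  "convex_on X (\<lambda>y. prox_objective c y - (\<rho> - (\<tau> + \<kappa>)) / 2 * (norm y)\<^sup>2)"
  unfolding prox_objective_def
proof (rule convex_on_add_prox)
  show "convex_on X (\<lambda>y. f y + \<omega> y + (\<tau> + \<kappa>) / 2 * (norm y)\<^sup>2)"
    using convex_on_add[OF f_weakly_convex \<omega>_convex] by (simp add: algebra_simps add_divide_distrib)
qed

lemma proximal_point:
  shows proximal_point_in: "proximal_point c \<in> X"
    and proximal_point_le: "y \<in> X \<Longrightarrow> envelope c \<le> prox_objective c y"
proof -
  have "continuous_on X (prox_objective c)"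
    unfolding prox_objective_def
    by (intro continuous_intros f_continuous \<omega>_continuous)
  moreover have "m \<le> prox_objective c y" if "y \<in> X" for y
    using lower[OF that] \<rho>_gt \<kappa>_nonneg \<tau>_nonneg by (simp add: prox_objective_def add_increasing2)
  ultimately have "\<exists>z\<in>X. \<forall>y\<in>X. prox_objective c z \<le> prox_objective c y"
    using \<rho>_gt closed_X X_nonempty
    by (intro strongly_convex_on_minimizer[OF prox_objective_convex]) auto
  then have *: "proximal_point c \<in> X \<and> (\<forall>y\<in>X. envelope c \<le> prox_objective c y)"
    unfolding envelope_def proximal_point_def by (rule_tac someI_ex) auto
  then show "proximal_point c \<in> X" "y \<in> X \<Longrightarrow> envelope c \<le> prox_objective c y" by auto
qed

lemma proximal_point_growth:
  "y \<in> X \<Longrightarrow> envelope c + (\<rho> - (\<tau> + \<kappa>)) / 2 * (norm (y - proximal_point c))\<^sup>2 \<le> prox_objective c y"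
  unfolding envelope_def
  using proximal_point_le proximal_point_in
  by (intro strongly_convex_on_growth[OF prox_objective_convex]) (auto simp: envelope_def)

lemma envelope_ge: "m \<le> envelope c"
  using lower[OF proximal_point_in, of c] \<rho>_gt \<kappa>_nonneg \<tau>_nonneg
  by (simp add: envelope_def prox_objective_def add_increasing2)

lemma envelope_le: "y \<in> X \<Longrightarrow> envelope y \<le> f y + \<omega> y"
  using proximal_point_le[of y y] by (simp add: prox_objective_def)

text \<open>Each proximal point competes in the other's problem. Adding the two growth inequalities
  cancels the values of \<open>f\<close> and \<omega>, and the remaining squares collapse to \<rho>
  times an inner product with \<open>c - d\<close>, to which Cauchy-Schwarz applies.\<close>

lemma proximal_point_lipschitz:
  "norm (proximal_point c - proximal_point d) \<le> \<rho> / (\<rho> - (\<tau> + \<kappa>)) * norm (c - d)"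
proof -
  define \<mu> where "\<mu> = \<rho> - (\<tau> + \<kappa>)"
  let ?x = "proximal_point c" and ?y = "proximal_point d"
  have \<rho>: "0 < \<rho>" and \<mu>: "0 < \<mu>" using \<rho>_gt \<kappa>_nonneg \<tau>_nonneg by (auto simp: \<mu>_def)
  have "prox_objective c ?x + \<mu> / 2 * (norm (?x - ?y))\<^sup>2 \<le> prox_objective c ?y"
    "prox_objective d ?y + \<mu> / 2 * (norm (?x - ?y))\<^sup>2 \<le> prox_objective d ?x"
    using proximal_point_growth[OF proximal_point_in, of c d] proximal_point_growth[OF proximal_point_in, of d c]
    unfolding envelope_def \<mu>_def norm_minus_commute[of ?x ?y] .
  then have "\<mu> * (norm (?x - ?y))\<^sup>2 \<le> \<rho> / 2 * (norm (?y - c))\<^sup>2 - \<rho> / 2 * (norm (?x - c))\<^sup>2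
      + \<rho> / 2 * (norm (?x - d))\<^sup>2 - \<rho> / 2 * (norm (?y - d))\<^sup>2"
    unfolding prox_objective_def by linarith
  also have "\<dots> = \<rho> * ((c - d) \<bullet> (?x - ?y))"
    by (simp add: power2_norm_eq_inner algebra_simps inner_commute)
  also have "\<dots> \<le> \<rho> * (norm (c - d) * norm (?x - ?y))"
    using \<rho> norm_cauchy_schwarz by (intro mult_left_mono) auto
  finally have *: "norm (?x - ?y) * (\<mu> * norm (?x - ?y)) \<le> norm (?x - ?y) * (\<rho> * norm (c - d))"
    by (simp add: power2_eq_square mult_ac)
  show ?thesis
  proof (cases "norm (?x - ?y) = 0")
    case False
    then have "\<mu> * norm (?x - ?y) \<le> \<rho> * norm (c - d)" using * by (simp add: mult_le_cancel_left)
    then show ?thesis using \<mu> unfolding \<mu>_def[symmetric] by (simp add: field_simps)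
  qed (use \<rho> \<mu> in \<open>simp add: \<mu>_def\<close>)
qed

lemma proximal_point_continuous: "continuous_on UNIV proximal_point"
proof -
  have "lipschitz_on (\<rho> / (\<rho> - (\<tau> + \<kappa>))) UNIV proximal_point"
    using proximal_point_lipschitz \<rho>_gt \<kappa>_nonneg \<tau>_nonneg
    by (intro lipschitz_onI) (auto simp: dist_norm)
  then show ?thesis by (rule lipschitz_on_continuous_on)
qed

text \<open>The proximal point of \<open>c\<close> is a competitor in the problem at
  \<open>y\<close>; expanding its square about \<open>c\<close> yields the linear and quadratic
  terms.\<close>

lemma envelope_upper: "envelope y \<le> envelope c + \<rho> * ((c - proximal_point c) \<bullet> (y - c)) + \<rho> / 2 * (norm (y - c))\<^sup>2"
proof -
  have "prox_objective y (proximal_point c) = prox_objective c (proximal_point c)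
      + \<rho> * ((c - proximal_point c) \<bullet> (y - c)) + \<rho> / 2 * (norm (y - c))\<^sup>2"
  proof -
    have eq: "(norm (p - y))\<^sup>2 = (norm (p - c))\<^sup>2 + 2 * ((c - p) \<bullet> (y - c)) + (norm (y - c))\<^sup>2" for p
      by (simp add: power2_norm_eq_inner inner_diff_left inner_diff_right inner_commute)
    show ?thesis unfolding prox_objective_def eq by (simp add: algebra_simps)
  qed
  then show ?thesis using proximal_point_le[OF proximal_point_in, of y c] by (simp add: envelope_def)
qed

text \<open>\<open>envelope_upper\<close> bounds the first-order remainder from above. With
  \<open>c\<close> and \<open>y\<close> exchanged it bounds it from below up to the change of slope,
  which is of quadratic order because proximal points are Lipschitz in the centre.\<close>

lemma GDERIV_envelope: "GDERIV envelope c :> \<rho> *\<^sub>R (c - proximal_point c)"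
  unfolding gderiv_def
proof (rule has_derivativeI)
  define g where "g = \<rho> *\<^sub>R (c - proximal_point c)"
  define b where "b y = (\<rho> * (1 + \<rho> / (\<rho> - (\<tau> + \<kappa>))) + \<rho>) * norm (y - c)" for y
  have \<rho>: "0 < \<rho>" using \<rho>_gt \<kappa>_nonneg \<tau>_nonneg by simp
  have "norm ((envelope y - envelope c - (y - c) \<bullet> g) /\<^sub>R norm (y - c)) \<le> b y" for y
  proof (cases "y = c")
    case False
    let ?d = "norm (y - c)" and ?q = "\<rho> / (\<rho> - (\<tau> + \<kappa>))"
    have "envelope y - envelope c - (y - c) \<bullet> g \<le> \<rho> / 2 * ?d\<^sup>2"
      using envelope_upper[of y c] by (simp add: g_def inner_commute)
    moreover have "- (envelope y - envelope c - (y - c) \<bullet> g) \<le> (\<rho> * (1 + ?q) + \<rho> / 2) * ?d\<^sup>2"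
    proof -
      have "- (envelope y - envelope c - (y - c) \<bullet> g)
        \<le> \<rho> / 2 * ?d\<^sup>2 + \<rho> * (((c - proximal_point c) - (y - proximal_point y)) \<bullet> (y - c))"
        using envelope_upper[of c y]
        by (simp add: g_def inner_commute norm_minus_commute inner_diff_left inner_diff_right algebra_simps)
      also have "((c - proximal_point c) - (y - proximal_point y)) \<bullet> (y - c) \<le> (1 + ?q) * ?d * ?d"
      proof (rule order_trans[OF norm_cauchy_schwarz mult_right_mono])
        show "norm ((c - proximal_point c) - (y - proximal_point y)) \<le> (1 + ?q) * ?d"
        proof -
        have "norm ((c - proximal_point c) - (y - proximal_point y))
          = norm ((c - y) - (proximal_point c - proximal_point y))" by (simp add: algebra_simps)
        also have "\<dots> \<le> norm (c - y) + ?q * norm (c - y)"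
          using norm_triangle_ineq4 proximal_point_lipschitz by (smt (verit))
        finally show ?thesis by (simp add: algebra_simps norm_minus_commute)
        qed
      qed simp
      finally show ?thesis using \<rho> by (simp add: power2_eq_square algebra_simps)
    qed
    moreover have "0 \<le> \<rho> * (1 + ?q)" using \<rho> \<rho>_gt by (intro mult_nonneg_nonneg add_nonneg_nonneg) auto
    moreover have "\<rho> / 2 * ?d\<^sup>2 \<le> (\<rho> * (1 + ?q) + \<rho>) * ?d\<^sup>2"
      "(\<rho> * (1 + ?q) + \<rho> / 2) * ?d\<^sup>2 \<le> (\<rho> * (1 + ?q) + \<rho>) * ?d\<^sup>2"
      using \<rho> \<open>0 \<le> \<rho> * (1 + ?q)\<close> by (intro mult_right_mono; simp)+
    ultimately have "\<bar>envelope y - envelope c - (y - c) \<bullet> g\<bar> \<le> (\<rho> * (1 + ?q) + \<rho>) * ?d\<^sup>2"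
      by linarith
    then have "\<bar>envelope y - envelope c - (y - c) \<bullet> g\<bar> \<le> b y * ?d"
      by (simp add: b_def power2_eq_square)
    then show ?thesis using False by (simp add: field_simps)
  qed (simp add: b_def)
  then have "\<forall>\<^sub>F y in at c. norm ((envelope y - envelope c - (y - c) \<bullet> g) /\<^sub>R norm (y - c)) \<le> b y"
    by (intro always_eventually allI)
  moreover have "continuous (at c) b"
    unfolding b_def[abs_def] by (intro continuous_intros)
  then have "(b \<longlongrightarrow> 0) (at c)" by (simp add: continuous_at b_def)
  ultimately show "((\<lambda>y. (envelope y - envelope c - (y - c) \<bullet> (\<rho> *\<^sub>R (c - proximal_point c))) /\<^sub>R norm (y - c)) \<longlongrightarrow> 0) (at c)"
    unfolding g_def[symmetric] by (rule Lim_null_comparison)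
qed (rule bounded_linear_inner_left)

lemma gradient_envelope: "gradient envelope c = \<rho> *\<^sub>R (c - proximal_point c)"
  unfolding gradient_def
proof (rule the_equality)
  show "GDERIV envelope c :> \<rho> *\<^sub>R (c - proximal_point c)" by (rule GDERIV_envelope)
next
  fix D assume "GDERIV envelope c :> D"
  then have "(\<lambda>h. h \<bullet> D) = (\<lambda>h. h \<bullet> (\<rho> *\<^sub>R (c - proximal_point c)))"
    using GDERIV_envelope[of c] unfolding gderiv_def by (rule has_derivative_unique)
  then have "h \<bullet> (D - \<rho> *\<^sub>R (c - proximal_point c)) = 0" for h
    unfolding inner_diff_right by (metis diff_self)
  then show "D = \<rho> *\<^sub>R (c - proximal_point c)"
    by (metis inner_eq_zero_iff right_minus_eq)
qed

lemma envelope_continuous: "continuous_on UNIV envelope"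
  using GDERIV_envelope by (auto simp: continuous_on_eq_continuous_at gderiv_def intro: has_derivative_continuous)

end

section \<open>Stopped Markov chains\<close>

text \<open>As in the paper, times start at 1; the value at time 0 is a dummy.\<close>

fun trajectory :: "('a \<Rightarrow> 's \<Rightarrow> 'a) \<Rightarrow> 'a \<Rightarrow> nat \<Rightarrow> (nat \<Rightarrow> 's) \<Rightarrow> 'a" where
  "trajectory P c 0 u = c"
| "trajectory P c (Suc 0) u = c"
| "trajectory P c (Suc (Suc k)) u = P (trajectory P c (Suc k) u) (u (Suc k))"

lemma trajectory_Suc: "1 \<le> k \<Longrightarrow> trajectory P c (Suc k) u = P (trajectory P c k u) (u k)"
  by (cases k) auto

lemma trajectory_cong:
  "(\<And>i. i \<in> {1..<k} \<Longrightarrow> u i = v i) \<Longrightarrow> trajectory P c k u = trajectory P c k v"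
  by (induction P c k u rule: trajectory.induct) auto

lemma trajectory_in:
  assumes "c \<in> X" "\<And>c s. c \<in> X \<Longrightarrow> s \<in> S \<Longrightarrow> P c s \<in> X" "\<And>i. i \<in> {1..<k} \<Longrightarrow> u i \<in> S"
  shows "trajectory P c k u \<in> X"
  using assms by (induction P c k u rule: trajectory.induct) auto

text \<open>The index set \<open>I\<close> is left open because an early state must also be
  measurable on products that contain later samples.\<close>

lemma measurable_trajectory:
  fixes P :: "'a::topological_space \<Rightarrow> 's \<Rightarrow> 'a"
  assumes [measurable]: "case_prod P \<in> borel_measurable (borel \<Otimes>\<^sub>M \<Xi>)"
  shows "{1..<k} \<subseteq> I \<Longrightarrow> trajectory P c k \<in> borel_measurable (Pi\<^sub>M I (\<lambda>_. \<Xi>))"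
proof (induction k)
  case (Suc k)
  show ?case
  proof (cases "k = 0")
    case False
    then have [simp]: "trajectory P c (Suc k) = (\<lambda>u. case_prod P (trajectory P c k u, u k))"
      by (auto simp: trajectory_Suc fun_eq_iff)
    have [measurable]: "trajectory P c k \<in> borel_measurable (Pi\<^sub>M I (\<lambda>_. \<Xi>))"
      by (rule Suc.IH[OF order_trans[OF _ Suc.prems]]) auto
    have [measurable]: "(\<lambda>u. u k) \<in> measurable (Pi\<^sub>M I (\<lambda>_. \<Xi>)) \<Xi>"
      using Suc.prems False by (intro measurable_component_singleton) auto
    show ?thesis by simp
  next
    case True
    then have "trajectory P c (Suc k) = (\<lambda>_. c)" by (simp add: fun_eq_iff)
    then show ?thesis by simp
  qed
next
  case 0
  have "trajectory P c 0 = (\<lambda>_. c)" by (simp add: fun_eq_iff)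
  then show ?case by simp
qed

text \<open>Stopping the chain when it leaves \<open>S\<close> and freezing the value \<open>t\<close> there yields a
  supermartingale; this combines the maximal inequality with the telescoped descent.\<close>

lemma stopped_chain_bound:
  fixes P :: "'a::topological_space \<Rightarrow> 's \<Rightarrow> 'a" and Y :: "nat \<Rightarrow> 'a \<Rightarrow> ennreal"
  assumes "prob_space \<Xi>"
    and P[measurable]: "case_prod P \<in> borel_measurable (borel \<Otimes>\<^sub>M \<Xi>)"
    and [measurable]: "S \<in> sets borel" "\<And>k. Y k \<in> borel_measurable borel" "a \<in> borel_measurable borel"
    and c: "c \<in> X" and PX: "\<And>c s. c \<in> X \<Longrightarrow> s \<in> space \<Xi> \<Longrightarrow> P c s \<in> X"
    and descent: "\<And>k c. 1 \<le> k \<Longrightarrow> k \<le> K \<Longrightarrow> c \<in> X \<Longrightarrow> c \<in> S \<Longrightarrow> (\<integral>\<^sup>+s. Y (Suc k) (P c s) \<partial>\<Xi>) + a c \<le> Y k c"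
    and exit: "\<And>k c. 1 \<le> k \<Longrightarrow> k \<le> Suc K \<Longrightarrow> c \<in> X \<Longrightarrow> c \<notin> S \<Longrightarrow> t \<le> Y k c"
    and k: "1 \<le> k" "k \<le> Suc K"
  defines "x \<equiv> trajectory P c"
  shows "(\<integral>\<^sup>+u. (if \<forall>j\<in>{1..k}. x j u \<in> S then Y k (x k u) else t)
      + (\<Sum>j\<in>{1..<k}. if \<forall>i\<in>{1..j}. x i u \<in> S then a (x j u) else 0) \<partial>Pi\<^sub>M {1..<k} (\<lambda>_. \<Xi>)) \<le> Y 1 c"
  using k
proof (induction k)
  case (Suc k)
  interpret \<Xi>: prob_space \<Xi> by fact
  interpret product_sigma_finite "\<lambda>_. \<Xi>" by standard
  \<comment> \<open>\<open>Z k\<close> reads only the states up to time \<open>k\<close>, hence only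
    the samples before \<open>k\<close>; this is why the product runs over
    \<open>{1..<k}\<close>.\<close>
  define Z where "Z k u = (if \<forall>j\<in>{1..k}. x j u \<in> S then Y k (x k u) else t)
      + (\<Sum>j\<in>{1..<k}. if \<forall>i\<in>{1..j}. x i u \<in> S then a (x j u) else 0)" for k u
  show ?case
  proof (cases "k = 0")
    case True
    interpret PE: prob_space "Pi\<^sub>M ({} :: nat set) (\<lambda>_. \<Xi>)" by (intro prob_space_PiM) (rule \<open>prob_space \<Xi>\<close>)
    have Z_1: "Z 1 u \<le> Y 1 c" for u using exit[of 1 c] c by (auto simp: Z_def x_def)
    have "(\<integral>\<^sup>+u. Z 1 u \<partial>Pi\<^sub>M {} (\<lambda>_. \<Xi>)) \<le> (\<integral>\<^sup>+u. Y 1 c \<partial>Pi\<^sub>M ({} :: nat set) (\<lambda>_. \<Xi>))"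
      by (intro nn_integral_mono Z_1)
    then have "(\<integral>\<^sup>+u. Z 1 u \<partial>Pi\<^sub>M {} (\<lambda>_. \<Xi>)) \<le> Y 1 c" by (simp add: PE.emeasure_space_1)
    then show ?thesis unfolding Z_def True One_nat_def by simp
  next
    case False
    then have k: "1 \<le> k" "k \<le> K" using Suc.prems by auto
    have ins: "{1..<Suc k} = insert k {1..<k}" using k by auto
    have x_meas: "x j \<in> borel_measurable (Pi\<^sub>M (insert k {1..<k}) (\<lambda>_. \<Xi>))" if "j \<le> Suc k" for j
      unfolding x_def by (rule measurable_trajectory[OF P]) (use that in auto)
    let ?N = "Pi\<^sub>M (insert k {1..<k}) (\<lambda>_. \<Xi>)"
    have past_meas: "{u \<in> space ?N. \<forall>i\<in>{1..j}. x i u \<in> S} \<in> sets ?N" if "j \<le> Suc k" for j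
    proof (rule sets.sets_Collect_finite_All)
      fix i assume "i \<in> {1..j}"
      then have [measurable]: "x i \<in> borel_measurable ?N"
        using that x_meas by auto
      show "{u \<in> space ?N. x i u \<in> S} \<in> sets ?N" by measurable
    qed simp
    have [measurable]: "x (Suc k) \<in> borel_measurable ?N" using x_meas by simp
    have Y_meas: "(\<lambda>u. Y (Suc k) (x (Suc k) u)) \<in> borel_measurable ?N" by measurable
    have a_meas: "(\<lambda>u. a (x j u)) \<in> borel_measurable ?N" if "j \<le> Suc k" for j
      by (rule measurable_compose[OF x_meas[OF that]]) simp
    have Z_meas: "Z (Suc k) \<in> borel_measurable ?N"
      unfolding Z_def[abs_def]
      by (intro borel_measurable_add borel_measurable_sum measurable_If past_meas Y_meas a_meas
          borel_measurable_const) auto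
    \<comment> \<open>One-step supermartingale inequality: the earlier samples are fixed in
      \<open>u\<close> and only the newest sample \<open>s\<close> is integrated. Fubini then
      finishes the induction.\<close>
    have step: "(\<integral>\<^sup>+s. Z (Suc k) (u(k := s)) \<partial>\<Xi>) \<le> Z k u"
      if u: "u \<in> space (Pi\<^sub>M {1..<k} (\<lambda>_. \<Xi>))" for u
    proof -
      have x_upd: "x j (u(k := s)) = x j u" if "j \<le> k" for j s
        unfolding x_def using that by (intro trajectory_cong) auto
      have x_Suc: "x (Suc k) (u(k := s)) = P (x k u) s" for s
      proof -
        have "x (Suc k) (u(k := s)) = P (x k (u(k := s))) s"
          unfolding x_def trajectory_Suc[OF k(1)] by simp
        then show ?thesis unfolding x_upd[OF order_refl] .
      qed
      have xX: "x k u \<in> X"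
        unfolding x_def
      proof (rule trajectory_in[where S = "space \<Xi>"])
        show "u i \<in> space \<Xi>" if "i \<in> {1..<k}" for i
          using u that by (auto simp: space_PiM)
      qed (fact c, rule PX)
      define past where "past = (\<Sum>j\<in>{1..<k}. if \<forall>i\<in>{1..j}. x i u \<in> S then a (x j u) else 0)"
      define A where "A \<longleftrightarrow> (\<forall>j\<in>{1..k}. x j u \<in> S)"
      have Z_k: "Z k u = (if A then Y k (x k u) else t) + past"
        by (simp add: Z_def past_def A_def)
      have Z_Suc: "Z (Suc k) (u(k := s)) = (if A \<and> P (x k u) s \<in> S then Y (Suc k) (P (x k u) s) else t)
        + ((if A then a (x k u) else 0) + past)" for s
      proof -
        have "(\<Sum>j\<in>{1..<Suc k}. if \<forall>i\<in>{1..j}. x i (u(k := s)) \<in> S then a (x j (u(k := s))) else 0)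
          = (if \<forall>i\<in>{1..k}. x i (u(k := s)) \<in> S then a (x k (u(k := s))) else 0)
            + (\<Sum>j\<in>{1..<k}. if \<forall>i\<in>{1..j}. x i (u(k := s)) \<in> S then a (x j (u(k := s))) else 0)"
          unfolding ins by simp
        also have "\<dots> = (if A then a (x k u) else 0) + past"
        proof -
          have "(\<forall>i\<in>{1..j}. x i (u(k := s)) \<in> S) \<longleftrightarrow> (\<forall>i\<in>{1..j}. x i u \<in> S)" if "j \<le> k" for j
            using that by (simp add: x_upd)
          moreover from this have "(\<Sum>j\<in>{1..<k}. if \<forall>i\<in>{1..j}. x i (u(k := s)) \<in> S then a (x j (u(k := s))) else 0) = past"
            unfolding past_def by (intro sum.cong refl) (simp add: x_upd)
          ultimately show ?thesis unfolding A_def by (simp add: x_upd)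
        qed
        finally have sum_eq: "(\<Sum>j\<in>{1..<Suc k}. if \<forall>i\<in>{1..j}. x i (u(k := s)) \<in> S then a (x j (u(k := s))) else 0)
          = (if A then a (x k u) else 0) + past" .
        have all_eq: "(\<forall>j\<in>{1..Suc k}. x j (u(k := s)) \<in> S) \<longleftrightarrow> A \<and> P (x k u) s \<in> S"
        proof -
          have "{1..Suc k} = insert (Suc k) {1..k}" by auto
          then show ?thesis unfolding A_def using x_upd by (auto simp: x_Suc)
        qed
        show ?thesis unfolding Z_def sum_eq all_eq x_Suc by simp
      qed
      have x_k_S: "A \<Longrightarrow> x k u \<in> S" using k by (auto simp: A_def)
      show ?thesis
      proof (cases A)
        case True
        have "(\<integral>\<^sup>+s. Z (Suc k) (u(k := s)) \<partial>\<Xi>) \<le> (\<integral>\<^sup>+s. Y (Suc k) (P (x k u) s) + (a (x k u) + past) \<partial>\<Xi>)"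
          unfolding Z_Suc
        proof (intro nn_integral_mono add_mono)
          fix s assume "s \<in> space \<Xi>"
          then show "(if A \<and> P (x k u) s \<in> S then Y (Suc k) (P (x k u) s) else t) \<le> Y (Suc k) (P (x k u) s)"
            using True exit[of "Suc k" "P (x k u) s"] k PX[OF xX] by simp
        qed (simp_all add: True)
        also have "\<dots> = (\<integral>\<^sup>+s. Y (Suc k) (P (x k u) s) \<partial>\<Xi>) + (a (x k u) + past)"
        proof (subst nn_integral_add)
          have "(\<lambda>s. Y (Suc k) (case_prod P (x k u, s))) \<in> borel_measurable \<Xi>" by measurable
          then show "(\<lambda>s. Y (Suc k) (P (x k u) s)) \<in> borel_measurable \<Xi>" by simp
        qed (auto simp: \<Xi>.emeasure_space_1)
        also have "\<dots> \<le> Y k (x k u) + past"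
          unfolding add.assoc[symmetric] by (intro add_right_mono descent[OF k xX x_k_S[OF True]])
        finally show ?thesis using True by (simp add: Z_k)
      next
        case False
        then show ?thesis unfolding Z_k Z_Suc by (simp add: \<Xi>.emeasure_space_1)
      qed
    qed
    have "(\<integral>\<^sup>+u. Z (Suc k) u \<partial>Pi\<^sub>M {1..<Suc k} (\<lambda>_. \<Xi>))
      = (\<integral>\<^sup>+u. (\<integral>\<^sup>+s. Z (Suc k) (u(k := s)) \<partial>\<Xi>) \<partial>Pi\<^sub>M {1..<k} (\<lambda>_. \<Xi>))"
      unfolding ins by (rule product_nn_integral_insert[OF _ _ Z_meas]) auto
    also have "\<dots> \<le> (\<integral>\<^sup>+u. Z k u \<partial>Pi\<^sub>M {1..<k} (\<lambda>_. \<Xi>))"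
      by (intro nn_integral_mono step)
    also have "\<dots> \<le> Y 1 c" unfolding Z_def using Suc.IH k by simp
    finally show ?thesis unfolding Z_def .
  qed
qed simp

section \<open>The stochastic model-based step\<close>

text \<open>The import renames types: \<open>'a\<close> is now the type of samples and
  \<open>'b\<close> the Euclidean space. \<open>\<gamma>_gt\<close> makes the objective of a step
  strongly convex.\<close>

locale stochastic_model = weakly_convex_model +
  fixes \<gamma> :: "'b \<Rightarrow> real"
  assumes model_measurable: "\<And>y. (\<lambda>(c, s). model c y s) \<in> borel_measurable (borel \<Otimes>\<^sub>M \<Xi>)"
    and \<gamma>_measurable: "\<gamma> \<in> borel_measurable borel"
    and \<gamma>_gt: "\<And>c. \<kappa> < \<gamma> c"
begin

lemma \<gamma>_pos: "0 < \<gamma> c"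
  using \<gamma>_gt[of c] \<kappa>_nonneg by simp

definition step_objective :: "'b \<Rightarrow> 'a \<Rightarrow> 'b \<Rightarrow> real" where
  "step_objective c s y = model c y s + \<omega> y + \<gamma> c / 2 * (norm (y - c))\<^sup>2"

text \<open>Models are convex only for centres in \<open>X\<close>. Projecting the centre makes the
  map well behaved on the whole space, as joint Borel measurability requires, and changes nothing
  for centres in \<open>X\<close>.\<close>

definition step :: "'b \<Rightarrow> 'a \<Rightarrow> 'b" where
  "step c s = (SOME z. z \<in> X \<and>
     (\<forall>y\<in>X. step_objective (closest_point X c) s z \<le> step_objective (closest_point X c) s y))"

lemma step_objective_convex:
  assumes "c \<in> X" "s \<in> space \<Xi>"
  shows "convex_on X (\<lambda>y. step_objective c s y - (\<gamma> c - \<kappa>) / 2 * (norm y)\<^sup>2)"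
  unfolding step_objective_def
  using convex_on_add[OF model_convex[OF assms] \<omega>_convex]
  by (intro convex_on_add_prox) (simp add: add.assoc)

lemma step_objective_continuous:
  assumes "s \<in> space \<Xi>"
  shows "continuous_on X (step_objective c s)"
proof -
  have "lipschitz_on (\<bar>Lip s\<bar> * G (norm c)) X (\<lambda>y. model c y s)"
  proof (rule lipschitz_onI)
    fix y z :: 'b
    have "Lip s * (G (norm c) * norm (y - z)) \<le> \<bar>Lip s\<bar> * (G (norm c) * norm (y - z))"
      by (intro mult_right_mono mult_nonneg_nonneg G_nonneg) auto
    then show "dist (model c y s) (model c z s) \<le> \<bar>Lip s\<bar> * G (norm c) * dist y z"
      using model_lip[OF assms, of c y z] model_lip[OF assms, of c z y]
      by (auto simp: dist_norm norm_minus_commute mult.assoc)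
  qed (simp add: G_nonneg)
  then have "continuous_on X (\<lambda>y. model c y s)" by (rule lipschitz_on_continuous_on)
  then show ?thesis
    unfolding step_objective_def by (intro continuous_intros \<omega>_continuous)
qed

text \<open>By the Lipschitz bounds, model plus \<omega> can fall below its value at
  \<open>c\<close> at most linearly in the distance, and the prox term limits this fall by
  completing the square.\<close>

lemma step_objective_lower:
  assumes "c \<in> X" "y \<in> X" "s \<in> space \<Xi>"
  shows "model c c s + \<omega> c - (Lip s * G (norm c) + L\<^sub>\<omega>)\<^sup>2 / (2 * \<gamma> c) \<le> step_objective c s y"
  using model_lip[OF assms(3), of c c y] \<omega>_lip[OF assms(1,2)]
    linear_minus_quadratic_le[OF \<gamma>_pos[of c], of "Lip s * G (norm c) + L\<^sub>\<omega>" "norm (c - y)"]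
  by (simp add: step_objective_def norm_minus_commute algebra_simps)

lemma step:
  assumes "s \<in> space \<Xi>"
  shows step_in: "step c s \<in> X"
    and step_le: "y \<in> X \<Longrightarrow> step_objective (closest_point X c) s (step c s) \<le> step_objective (closest_point X c) s y"
proof -
  have c: "closest_point X c \<in> X" using closed_X X_nonempty by (rule closest_point_in_set)
  have "\<exists>z\<in>X. \<forall>y\<in>X. step_objective (closest_point X c) s z \<le> step_objective (closest_point X c) s y"
  proof (rule strongly_convex_on_minimizer[OF step_objective_convex[OF c assms] _ closed_X X_nonempty
        step_objective_continuous[OF assms] ballI[OF step_objective_lower[OF c _ assms]]])
    show "0 < \<gamma> (closest_point X c) - \<kappa>" using \<gamma>_gt by simp
  qed
  then have "step c s \<in> X \<and> (\<forall>y\<in>X. step_objective (closest_point X c) s (step c s) \<le> step_objective (closest_point X c) s y)"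
    unfolding step_def by (rule_tac someI_ex) auto
  then show "step c s \<in> X"
    "y \<in> X \<Longrightarrow> step_objective (closest_point X c) s (step c s) \<le> step_objective (closest_point X c) s y"
    by auto
qed

lemma step_growth:
  assumes "s \<in> space \<Xi>" "y \<in> X"
  shows "step_objective (closest_point X c) s (step c s)
    + (\<gamma> (closest_point X c) - \<kappa>) / 2 * (norm (y - step c s))\<^sup>2 \<le> step_objective (closest_point X c) s y"
  using step[OF assms(1)] assms closest_point_in_set[OF closed_X X_nonempty]
  by (intro strongly_convex_on_growth[OF step_objective_convex]) auto

text \<open>Identifies whatever minimizer a run selects with the measurable map
  \<open>step\<close>.\<close>

lemma step_unique:
  assumes "c \<in> X" "s \<in> space \<Xi>" "z \<in> X" "\<And>y. y \<in> X \<Longrightarrow> step_objective c s z \<le> step_objective c s y"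
  shows "z = step c s"
proof -
  have "(\<gamma> c - \<kappa>) / 2 * (norm (z - step c s))\<^sup>2 \<le> 0"
    using step_growth[OF assms(2,3), of c] assms(4)[OF step_in[OF assms(2), of c]] assms(1)
    by (simp add: closest_point_self)
  then show ?thesis using \<gamma>_gt[of c] by (simp add: mult_le_0_iff)
qed

lemma measurable_step: "case_prod step \<in> borel_measurable (borel \<Otimes>\<^sub>M \<Xi>)"
proof (rule borel_measurable_strongly_convex_argmin[where X = X
      and h = "\<lambda>w. step_objective (closest_point X (fst w)) (snd w)"
      and \<mu> = "\<lambda>w. \<gamma> (closest_point X (fst w)) - \<kappa>"])
  have [measurable]: "closest_point X \<in> borel_measurable borel"
    using convex_X closed_X X_nonempty
    by (intro borel_measurable_continuous_onI continuous_on_closest_point)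
  note \<gamma>_measurable[measurable]
  fix y
  have "(\<lambda>w. case_prod (\<lambda>c s. model c y s) (closest_point X (fst w), snd w)) \<in> borel_measurable (borel \<Otimes>\<^sub>M \<Xi>)"
    by (rule measurable_compose[OF _ model_measurable]) measurable
  then have [measurable]: "(\<lambda>w. model (closest_point X (fst w)) y (snd w)) \<in> borel_measurable (borel \<Otimes>\<^sub>M \<Xi>)"
    by simp
  show "(\<lambda>w. step_objective (closest_point X (fst w)) (snd w) y) \<in> borel_measurable (borel \<Otimes>\<^sub>M \<Xi>)"
    unfolding step_objective_def by measurable
next
  fix w :: "'b \<times> 'a" and y assume "w \<in> space (borel \<Otimes>\<^sub>M \<Xi>)" "y \<in> X"
  then show "step_objective (closest_point X (fst w)) (snd w) (case_prod step w)
      + (\<gamma> (closest_point X (fst w)) - \<kappa>) / 2 * (norm (y - case_prod step w))\<^sup>2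
    \<le> step_objective (closest_point X (fst w)) (snd w) y"
    unfolding case_prod_beta by (intro step_growth) (auto simp: space_pair_measure)
qed (auto simp: space_pair_measure X_nonempty \<gamma>_gt intro!: step_objective_continuous step_in)

text \<open>The new iterate no longer occurs on the right-hand side, so expectations involve the
  model only at the fixed points \<open>c\<close> and \<open>proximal_point c\<close>, where
  condition (M) applies.\<close>

lemma step_distance:
  assumes "c \<in> X" "s \<in> space \<Xi>"
  shows "(\<gamma> c - \<kappa>) / 2 * (norm (proximal_point c - step c s))\<^sup>2
    \<le> model c (proximal_point c) s - model c c s + \<omega> (proximal_point c) - \<omega> c
      + \<gamma> c / 2 * (norm (proximal_point c - c))\<^sup>2 + (Lip s * G (norm c) + L\<^sub>\<omega>)\<^sup>2 / (2 * \<gamma> c)"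
  using step_growth[OF assms(2) proximal_point_in, of c c]
    step_objective_lower[OF assms(1) step_in[OF assms(2), of c] assms(2)] assms
  by (simp add: closest_point_self step_objective_def)

text \<open>The proximal point of \<open>c\<close> competes in the envelope at the new iterate,
  which reduces the claim to the distance in \<open>step_distance\<close>. Subtracting
  \<open>m\<close> and writing the decrease on the left keeps every term nonnegative, as
  \<open>ennreal\<close> demands.\<close>

lemma envelope_descent:
  assumes c: "c \<in> X"
  shows "(\<integral>\<^sup>+s. ennreal (envelope (step c s) - m) \<partial>\<Xi>)
      + ennreal (\<rho> * (\<rho> - \<tau> - \<kappa>) / (\<gamma> c - \<kappa>) * (norm (proximal_point c - c))\<^sup>2)
    \<le> ennreal (envelope c - m + \<rho> * (L\<^sub>f * G (norm c) + L\<^sub>\<omega>)\<^sup>2 / (2 * \<gamma> c * (\<gamma> c - \<kappa>)))"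
proof -
  let ?x = "proximal_point c"
  define d where "d = (norm (?x - c))\<^sup>2"
  \<comment> \<open>Rescales the modulus \<open>\<gamma> c - \<kappa>\<close> of the step to the
    weight \<rho> of the envelope; the distance term then becomes \<open>\<rho> / 2 * d\<close> and
    completes \<open>envelope c\<close>.\<close>
  define q where "q = \<rho> / (\<gamma> c - \<kappa>)"
  have \<rho>: "0 < \<rho>" using \<rho>_gt \<kappa>_nonneg \<tau>_nonneg by simp
  have q: "0 < q" using \<rho> \<gamma>_gt[of c] by (simp add: q_def)
  define H where "H s = f ?x + \<omega> ?x + q * (model c ?x s - model c c s + \<omega> ?x - \<omega> c
      + \<gamma> c / 2 * d + (Lip s * G (norm c) + L\<^sub>\<omega>)\<^sup>2 / (2 * \<gamma> c)) - m" for s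
  have le_H: "envelope (step c s) - m \<le> H s" if s: "s \<in> space \<Xi>" for s
  proof -
    have "envelope (step c s) \<le> f ?x + \<omega> ?x + q * ((\<gamma> c - \<kappa>) / 2 * (norm (?x - step c s))\<^sup>2)"
      using proximal_point_le[OF proximal_point_in, of "step c s" c] \<gamma>_gt[of c]
      by (simp add: prox_objective_def q_def)
    also have "\<dots> \<le> H s + m"
      unfolding H_def d_def using step_distance[OF c s] q by (simp add: mult_left_mono)
    finally show ?thesis by simp
  qed
  note [simp] = integrable_model[OF c proximal_point_in] integrable_model[OF c c]
    integral_Lip_affine_square_le(1)[OF G_nonneg]
  have H_int: "integrable \<Xi> H" unfolding H_def[abs_def] by simp
  have E: "(\<integral>s. H s \<partial>\<Xi>) = f ?x + \<omega> ?x + q * ((\<integral>s. model c ?x s \<partial>\<Xi>) - f c + \<omega> ?x - \<omega> c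
      + \<gamma> c / 2 * d + (\<integral>s. (Lip s * G (norm c) + L\<^sub>\<omega>)\<^sup>2 \<partial>\<Xi>) / (2 * \<gamma> c)) - m"
    unfolding H_def[abs_def] by (simp add: prob_space integral_model_center[OF c])
  define e where "e = (L\<^sub>f * G (norm c) + L\<^sub>\<omega>)\<^sup>2 / (2 * \<gamma> c)"
  have "(\<integral>s. model c ?x s \<partial>\<Xi>) \<le> f ?x + \<tau> / 2 * d"
    using integral_model_le[OF c proximal_point_in] by (simp add: d_def norm_minus_commute)
  moreover have "(\<integral>s. (Lip s * G (norm c) + L\<^sub>\<omega>)\<^sup>2 \<partial>\<Xi>) / (2 * \<gamma> c) \<le> e"
    unfolding e_def using integral_Lip_affine_square_le(2)[OF G_nonneg[of c]] \<gamma>_pos[of c]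
    by (intro divide_right_mono) auto
  moreover have "f ?x + \<omega> ?x + \<rho> / 2 * d + (\<rho> - (\<tau> + \<kappa>)) / 2 * d \<le> f c + \<omega> c"
    using proximal_point_growth[OF c, of c]
    by (simp add: envelope_def prox_objective_def d_def norm_minus_commute)
  \<comment> \<open>Half of the gain \<open>\<rho> - \<tau> - \<kappa>\<close> is the growth of the
    proximal objective; the other half is what \<open>\<rho> / 2\<close> leaves after paying
    \<open>\<tau> / 2\<close> for accuracy and \<open>\<kappa> / 2\<close> for splitting off
    \<open>\<gamma> c - \<kappa>\<close>.\<close>
  ultimately have "(\<integral>s. model c ?x s \<partial>\<Xi>) - f c + \<omega> ?x - \<omega> c + \<gamma> c / 2 * d
      + (\<integral>s. (Lip s * G (norm c) + L\<^sub>\<omega>)\<^sup>2 \<partial>\<Xi>) / (2 * \<gamma> c)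
    \<le> ((\<gamma> c - \<kappa>) / 2 * d - (\<rho> - \<tau> - \<kappa>) * d) + e"
    by (simp add: algebra_simps add_divide_distrib diff_divide_distrib)
  then have "(\<integral>s. H s \<partial>\<Xi>) \<le> f ?x + \<omega> ?x + q * (((\<gamma> c - \<kappa>) / 2 * d - (\<rho> - \<tau> - \<kappa>) * d) + e) - m"
    unfolding E using q by (simp add: mult_left_mono)
  also have "q * (((\<gamma> c - \<kappa>) / 2 * d - (\<rho> - \<tau> - \<kappa>) * d) + e)
    = q * ((\<gamma> c - \<kappa>) / 2 * d) - q * ((\<rho> - \<tau> - \<kappa>) * d) + q * e"
    by (simp add: algebra_simps)
  also have "q * ((\<gamma> c - \<kappa>) / 2 * d) = \<rho> / 2 * d" using \<gamma>_gt[of c] by (simp add: q_def)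
  finally have H_le: "(\<integral>s. H s \<partial>\<Xi>) \<le> envelope c - m - q * ((\<rho> - \<tau> - \<kappa>) * d) + q * e"
    by (simp add: envelope_def prox_objective_def d_def)
  define r where "r = \<rho> * (\<rho> - \<tau> - \<kappa>) / (\<gamma> c - \<kappa>) * (norm (?x - c))\<^sup>2"
  have r: "r = q * ((\<rho> - \<tau> - \<kappa>) * d)" "0 \<le> r"
    using \<rho> \<rho>_gt \<gamma>_gt[of c] by (auto simp: r_def q_def d_def)
  have H_nonneg: "0 \<le> H s" if "s \<in> space \<Xi>" for s
    using le_H[OF that] envelope_ge[of "step c s"] by linarith
  have "(\<integral>\<^sup>+s. ennreal (envelope (step c s) - m) \<partial>\<Xi>) \<le> (\<integral>\<^sup>+s. ennreal (H s) \<partial>\<Xi>)"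
    by (intro nn_integral_mono ennreal_leI le_H)
  also have "\<dots> = ennreal (\<integral>s. H s \<partial>\<Xi>)"
    using H_int H_nonneg by (intro nn_integral_eq_integral AE_I2) auto
  finally have "(\<integral>\<^sup>+s. ennreal (envelope (step c s) - m) \<partial>\<Xi>) + ennreal r \<le> ennreal (\<integral>s. H s \<partial>\<Xi>) + ennreal r"
    by (rule add_right_mono)
  also have "\<dots> = ennreal ((\<integral>s. H s \<partial>\<Xi>) + r)"
    using H_nonneg r by (intro ennreal_plus[symmetric] integral_nonneg_AE AE_I2) auto
  also have "\<dots> \<le> ennreal (envelope c - m + q * e)"
    using H_le r by (intro ennreal_leI) simp
  also have "q * e = \<rho> * (L\<^sub>f * G (norm c) + L\<^sub>\<omega>)\<^sup>2 / (2 * \<gamma> c * (\<gamma> c - \<kappa>))"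
    by (simp add: q_def e_def)
  finally show ?thesis unfolding r_def .
qed


text \<open>Equals \<open>(\<rho> - \<tau> - \<kappa>) / (\<rho> * (\<gamma> c - \<kappa>))\<close>
  times the squared norm of the envelope's gradient at \<open>c\<close>.\<close>

definition descent :: "'b \<Rightarrow> real" where
  "descent c = \<rho> * (\<rho> - \<tau> - \<kappa>) / (\<gamma> c - \<kappa>) * (norm (proximal_point c - c))\<^sup>2"

lemma envelope_measurable: "envelope \<in> borel_measurable borel"
  using envelope_continuous by (rule borel_measurable_continuous_onI)

lemma proximal_point_measurable: "proximal_point \<in> borel_measurable borel"
  using proximal_point_continuous by (rule borel_measurable_continuous_onI)

lemma descent_measurable: "descent \<in> borel_measurable borel"
proof -
  note [measurable] = proximal_point_measurable \<gamma>_measurable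
  show ?thesis unfolding descent_def[abs_def] by measurable
qed

text \<open>Numerator and denominator both carry the square of \<open>G (norm c) + 1\<close>. The
  added 1 absorbs the constant of \<omega>, which is not multiplied by \<open>G\<close>, and keeps
  the cancelled factor nonzero.\<close>

lemma step_noise_le:
  assumes \<alpha>: "0 < \<alpha>" and K: "1 \<le> (K::nat)"
    and \<gamma>: "\<kappa> + \<alpha> * (G (norm c) + 1) * sqrt (real K) \<le> \<gamma> c"
  shows "\<rho> * (L\<^sub>f * G (norm c) + L\<^sub>\<omega>)\<^sup>2 / (2 * \<gamma> c * (\<gamma> c - \<kappa>))
    \<le> \<rho> * (L\<^sub>f + L\<^sub>\<omega>)\<^sup>2 / (2 * \<alpha>\<^sup>2) / real K"
proof -
  let ?g = "G (norm c) + 1" and ?L = "L\<^sub>f + L\<^sub>\<omega>"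
  have \<rho>: "0 < \<rho>" using \<rho>_gt \<kappa>_nonneg \<tau>_nonneg by simp
  have g: "1 \<le> ?g" using G_nonneg by simp
  have "L\<^sub>f * G (norm c) + L\<^sub>\<omega> \<le> ?L * ?g"
    using L\<^sub>f_nonneg L\<^sub>\<omega>_nonneg G_nonneg[of c] by (simp add: algebra_simps)
  then have num: "(L\<^sub>f * G (norm c) + L\<^sub>\<omega>)\<^sup>2 \<le> (?L * ?g)\<^sup>2"
    using L\<^sub>f_nonneg L\<^sub>\<omega>_nonneg G_nonneg[of c] by (intro power_mono) auto
  let ?r = "\<alpha> * ?g * sqrt (real K)"
  have r: "0 < ?r" using \<alpha> g K by simp
  have "?r * ?r \<le> \<gamma> c * (\<gamma> c - \<kappa>)"
    using \<gamma> \<kappa>_nonneg r by (intro mult_mono) auto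
  moreover have "?r * ?r = \<alpha>\<^sup>2 * ?g\<^sup>2 * real K"
    using K by (simp add: power2_eq_square algebra_simps)
  ultimately have den: "\<alpha>\<^sup>2 * ?g\<^sup>2 * real K \<le> \<gamma> c * (\<gamma> c - \<kappa>)" by simp
  have pos: "0 < \<alpha>\<^sup>2 * ?g\<^sup>2 * real K" using \<alpha> g K by simp
  have "\<rho> * (L\<^sub>f * G (norm c) + L\<^sub>\<omega>)\<^sup>2 / (2 * \<gamma> c * (\<gamma> c - \<kappa>))
      \<le> \<rho> * (?L * ?g)\<^sup>2 / (2 * (\<alpha>\<^sup>2 * ?g\<^sup>2 * real K))"
    using num den pos \<rho> by (intro frac_le mult_left_mono) (auto simp: mult.assoc)
  also have "\<dots> = \<rho> * ?L\<^sup>2 / (2 * \<alpha>\<^sup>2) / real K"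
  proof -
    have "r * (l * g) / (2 * (a * g * k)) = r * l / (2 * a) / k" if "g \<noteq> 0" for r l a g k :: real
      using that by simp
    from this[of "?g\<^sup>2"] show ?thesis using g unfolding power_mult_distrib by simp
  qed
  finally show ?thesis .
qed

lemma stopped_run_bound:
  fixes K :: nat and v :: real
  assumes \<alpha>: "0 < \<alpha>" and K: "1 \<le> K"
    and \<gamma>: "\<And>c. \<kappa> + \<alpha> * (G (norm c) + 1) * sqrt (real K) \<le> \<gamma> c"
    and c: "c \<in> X"
  defines "\<epsilon> \<equiv> \<rho> * (L\<^sub>f + L\<^sub>\<omega>)\<^sup>2 / (2 * \<alpha>\<^sup>2)"
    and "x \<equiv> trajectory step c" and "S \<equiv> {y. envelope y \<le> v}"
  shows "(\<integral>\<^sup>+u. (if \<forall>j\<in>{1..Suc K}. x j u \<in> S then 0 else ennreal (v - m))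
      + (\<Sum>j\<in>{1..K}. if \<forall>i\<in>{1..j}. x i u \<in> S then ennreal (descent (x j u)) else 0) \<partial>Pi\<^sub>M {1..K} (\<lambda>_. \<Xi>))
    \<le> ennreal (envelope c - m + \<epsilon>)"
proof -
  note [measurable] = envelope_measurable descent_measurable
  \<comment> \<open>The second summand is the noise budget of the \<open>Suc K - k\<close> remaining
    steps: \<epsilon> at time 1 and 0 at time \<open>Suc K\<close>.\<close>
  define Y where "Y k y = ennreal (envelope y - m + (real (Suc K) - real k) * (\<epsilon> / real K))" for k y
  have \<rho>: "0 < \<rho>" using \<rho>_gt \<kappa>_nonneg \<tau>_nonneg by simp
  have \<epsilon>: "0 \<le> \<epsilon> / real K" using \<rho> by (simp add: \<epsilon>_def)
  have "(\<integral>\<^sup>+u. (if \<forall>j\<in>{1..Suc K}. x j u \<in> S then 0 else ennreal (v - m))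
      + (\<Sum>j\<in>{1..K}. if \<forall>i\<in>{1..j}. x i u \<in> S then ennreal (descent (x j u)) else 0) \<partial>Pi\<^sub>M {1..K} (\<lambda>_. \<Xi>))
    \<le> (\<integral>\<^sup>+u. (if \<forall>j\<in>{1..Suc K}. x j u \<in> S then Y (Suc K) (x (Suc K) u) else ennreal (v - m))
      + (\<Sum>j\<in>{1..<Suc K}. if \<forall>i\<in>{1..j}. x i u \<in> S then ennreal (descent (x j u)) else 0) \<partial>Pi\<^sub>M {1..<Suc K} (\<lambda>_. \<Xi>))"
    unfolding atLeastLessThanSuc_atLeastAtMost by (intro nn_integral_mono add_mono) auto
  also have "\<dots> \<le> Y 1 c"
    unfolding x_def
  proof (rule stopped_chain_bound[where X = X])
    fix k c assume k: "1 \<le> k" "k \<le> K" and c: "c \<in> X"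
    define r where "r = (real (Suc K) - real (Suc k)) * (\<epsilon> / real K)"
    have r: "0 \<le> r" using k \<epsilon> unfolding r_def by (intro mult_nonneg_nonneg) auto
    have "(\<integral>\<^sup>+s. Y (Suc k) (step c s) \<partial>\<Xi>) = (\<integral>\<^sup>+s. ennreal (envelope (step c s) - m) + ennreal r \<partial>\<Xi>)"
      unfolding Y_def r_def[symmetric] using r envelope_ge by (intro nn_integral_cong ennreal_plus) auto
    also have "\<dots> = (\<integral>\<^sup>+s. ennreal (envelope (step c s) - m) \<partial>\<Xi>) + ennreal r"
    proof (subst nn_integral_add)
      have "(\<lambda>s. case_prod step (c, s)) \<in> borel_measurable \<Xi>"
        by (rule measurable_compose[OF _ measurable_step]) simp
      then have [measurable]: "step c \<in> borel_measurable \<Xi>" by simp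
      show "(\<lambda>s. ennreal (envelope (step c s) - m)) \<in> borel_measurable \<Xi>" by measurable
    qed (simp_all add: emeasure_space_1)
    finally have "(\<integral>\<^sup>+s. Y (Suc k) (step c s) \<partial>\<Xi>) + ennreal (descent c)
      = (\<integral>\<^sup>+s. ennreal (envelope (step c s) - m) \<partial>\<Xi>) + ennreal (descent c) + ennreal r"
      by (simp add: ac_simps)
    also have "\<dots> \<le> ennreal (envelope c - m + \<epsilon> / real K) + ennreal r"
      unfolding descent_def \<epsilon>_def
      by (intro add_right_mono order_trans[OF envelope_descent[OF c]] ennreal_leI add_left_mono
          step_noise_le[OF \<alpha> K \<gamma>])
    also have "\<dots> = Y k c"
      unfolding Y_def r_def using r[unfolded r_def] \<epsilon> envelope_ge[of c]
      by (subst ennreal_plus[symmetric]) (auto simp: algebra_simps add_divide_distrib diff_divide_distrib)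
    finally show "(\<integral>\<^sup>+s. Y (Suc k) (step c s) \<partial>\<Xi>) + ennreal (descent c) \<le> Y k c" .
  next
    fix k c assume "1 \<le> k" "k \<le> Suc K" "c \<notin> S"
    moreover have "0 \<le> (real (Suc K) - real k) * (\<epsilon> / real K)"
      using \<epsilon> \<open>k \<le> Suc K\<close> by (intro mult_nonneg_nonneg) auto
    ultimately show "ennreal (v - m) \<le> Y k c"
      unfolding Y_def S_def by (intro ennreal_leI) auto
  next
    show "S \<in> sets borel" unfolding S_def by measurable
    show "Y k \<in> borel_measurable borel" for k unfolding Y_def[abs_def] by measurable
    show "(\<lambda>y. ennreal (descent y)) \<in> borel_measurable borel" by measurable
  qed (auto simp: prob_space_axioms measurable_step c step_in)
  also have "Y 1 c = ennreal (envelope c - m + \<epsilon>)" using K by (simp add: Y_def)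
  finally show ?thesis .
qed

text \<open>Independence makes the joint law of the samples a product measure, and the iterates are
  functions of the samples, so the stopped bound transfers to \<open>M\<close>. The last two bounds
  come from the same stopped integral, each by dropping the other summand.\<close>

lemma run_bounds:
  fixes K :: nat and v :: real and M :: "'w measure" and \<xi> :: "nat \<Rightarrow> 'w \<Rightarrow> 'a"
  assumes \<alpha>: "0 < \<alpha>" and K: "1 \<le> K"
    and \<gamma>: "\<And>c. \<kappa> + \<alpha> * (G (norm c) + 1) * sqrt (real K) \<le> \<gamma> c"
    and c: "c \<in> X"
    and M: "prob_space M" "prob_space.indep_vars M (\<lambda>_. \<Xi>) \<xi> {1..K}" "\<And>k. k \<in> {1..K} \<Longrightarrow> distr M \<Xi> (\<xi> k) = \<Xi>"
    and x: "\<And>w. w \<in> space M \<Longrightarrow> x 1 w = c"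
      "\<And>w k. w \<in> space M \<Longrightarrow> k \<in> {1..K} \<Longrightarrow> x (Suc k) w = step (x k w) (\<xi> k w)"
  defines "\<epsilon> \<equiv> \<rho> * (L\<^sub>f + L\<^sub>\<omega>)\<^sup>2 / (2 * \<alpha>\<^sup>2)"
    and "E \<equiv> {w \<in> space M. \<forall>j\<in>{1..Suc K}. envelope (x j w) \<le> v}"
  shows "\<And>j. j \<in> {1..Suc K} \<Longrightarrow> x j \<in> borel_measurable M"
    and "E \<in> sets M"
    and "ennreal (v - m) * emeasure M (space M - E) \<le> ennreal (envelope c - m + \<epsilon>)"
    and "(\<Sum>j\<in>{1..K}. \<integral>\<^sup>+w. ennreal (descent (x j w)) * indicator E w \<partial>M) \<le> ennreal (envelope c - m + \<epsilon>)"
proof -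
  interpret M: prob_space M by fact
  note [measurable] = envelope_measurable descent_measurable
  let ?N = "Pi\<^sub>M {1..K} (\<lambda>_. \<Xi>)"
  define T where "T w = (\<lambda>i\<in>{1..K}. \<xi> i w)" for w
  have \<xi>_meas: "\<xi> k \<in> measurable M \<Xi>" if "k \<in> {1..K}" for k
    using M(2) that by (auto simp: M.indep_vars_def)
  have T_meas[measurable]: "T \<in> measurable M ?N"
    unfolding T_def[abs_def] using \<xi>_meas by (rule measurable_restrict)
  have distr_T: "distr M ?N T = ?N"
  proof -
    have "distr M ?N T = Pi\<^sub>M {1..K} (\<lambda>k. distr M \<Xi> (\<xi> k))"
      unfolding T_def[abs_def] using M(2) K \<xi>_meas by (subst M.indep_vars_iff_distr_eq_PiM'[symmetric]) auto
    also have "\<dots> = ?N" using M(3) by (intro PiM_cong) auto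
    finally show ?thesis .
  qed
  let ?t = "trajectory step c"
  have x_eq: "x j w = ?t j (T w)" if w: "w \<in> space M" and "j \<in> {1..Suc K}" for j w
    using that(2)
  proof (induction j)
    case (Suc j)
    show ?case
    proof (cases "j = 0")
      case True
      then show ?thesis using x(1)[OF w] by simp
    next
      case False
      then have "j \<in> {1..K}" using Suc.prems by auto
      moreover from this have "T w j = \<xi> j w" by (simp add: T_def)
      ultimately show ?thesis
        using Suc.IH x(2)[OF w, of j] trajectory_Suc[of j step c "T w"] by simp
    qed
  qed simp
  have t_meas: "?t j \<in> borel_measurable ?N" if "j \<in> {1..Suc K}" for j
    using that by (intro measurable_trajectory[OF measurable_step]) auto
  show x_meas: "x j \<in> borel_measurable M" if "j \<in> {1..Suc K}" for j
    using measurable_compose[OF T_meas t_meas[OF that]]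
    by (subst measurable_cong[OF x_eq]) (use that in auto)
  show E: "E \<in> sets M"
    unfolding E_def
  proof (rule sets.sets_Collect_finite_All)
    fix j assume "j \<in> {1..Suc K}"
    then have [measurable]: "x j \<in> borel_measurable M" by (rule x_meas)
    show "{w \<in> space M. envelope (x j w) \<le> v} \<in> sets M" by measurable
  qed simp
  define A where "A = {u \<in> space ?N. \<forall>j\<in>{1..Suc K}. envelope (?t j u) \<le> v}"
  have A[measurable]: "A \<in> sets ?N"
    unfolding A_def
  proof (rule sets.sets_Collect_finite_All)
    fix j assume "j \<in> {1..Suc K}"
    then have [measurable]: "?t j \<in> borel_measurable ?N" by (rule t_meas)
    show "{u \<in> space ?N. envelope (?t j u) \<le> v} \<in> sets ?N" by measurable
  qed simp
  have TA: "T w \<in> A \<longleftrightarrow> w \<in> E" if "w \<in> space M" for w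
    using that measurable_space[OF T_meas that] x_eq[OF that] by (auto simp: A_def E_def)
  have transfer: "(\<integral>\<^sup>+w. g (T w) \<partial>M) = (\<integral>\<^sup>+u. g u \<partial>?N)" if "g \<in> borel_measurable ?N" for g
    using nn_integral_distr[OF T_meas, of g] that distr_T by simp
  let ?b = "ennreal (envelope c - m + \<epsilon>)"
  note bound = stopped_run_bound[OF \<alpha> K \<gamma> c, of v, folded \<epsilon>_def]
  have "ennreal (v - m) * emeasure M (space M - E) = (\<integral>\<^sup>+w. ennreal (v - m) * indicator (space M - E) w \<partial>M)"
    using E by (simp add: nn_integral_cmult)
  also have "\<dots> = (\<integral>\<^sup>+w. ennreal (v - m) * indicator (space ?N - A) (T w) \<partial>M)"
    using TA measurable_space[OF T_meas] by (intro nn_integral_cong) (auto simp: indicator_def)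
  also have "\<dots> = (\<integral>\<^sup>+u. ennreal (v - m) * indicator (space ?N - A) u \<partial>?N)"
    by (rule transfer) measurable
  also have "\<dots> \<le> ?b"
    by (rule order_trans[OF nn_integral_mono bound]) (auto simp: A_def indicator_def)
  finally show "ennreal (v - m) * emeasure M (space M - E) \<le> ?b" .
  have "(\<Sum>j\<in>{1..K}. \<integral>\<^sup>+w. ennreal (descent (x j w)) * indicator E w \<partial>M)
    = (\<Sum>j\<in>{1..K}. \<integral>\<^sup>+u. ennreal (descent (?t j u)) * indicator A u \<partial>?N)"
  proof (intro sum.cong refl)
    fix j assume j: "j \<in> {1..K}"
    then have [measurable]: "?t j \<in> borel_measurable ?N" by (intro t_meas) auto
    have "(\<integral>\<^sup>+w. ennreal (descent (x j w)) * indicator E w \<partial>M)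
      = (\<integral>\<^sup>+w. ennreal (descent (?t j (T w))) * indicator A (T w) \<partial>M)"
      using j TA x_eq by (intro nn_integral_cong) (auto simp: indicator_def)
    also have "\<dots> = (\<integral>\<^sup>+u. ennreal (descent (?t j u)) * indicator A u \<partial>?N)"
      by (rule transfer) measurable
    finally show "(\<integral>\<^sup>+w. ennreal (descent (x j w)) * indicator E w \<partial>M)
      = (\<integral>\<^sup>+u. ennreal (descent (?t j u)) * indicator A u \<partial>?N)" .
  qed
  also have "\<dots> = (\<integral>\<^sup>+u. (\<Sum>j\<in>{1..K}. ennreal (descent (?t j u)) * indicator A u) \<partial>?N)"
  proof (rule nn_integral_sum[symmetric])
    fix j assume "j \<in> {1..K}"
    then have [measurable]: "?t j \<in> borel_measurable ?N" by (intro t_meas) auto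
    show "(\<lambda>u. ennreal (descent (?t j u)) * indicator A u) \<in> borel_measurable ?N" by measurable
  qed
  also have "\<dots> \<le> ?b"
  proof (rule order_trans[OF nn_integral_mono bound])
    fix u
    have "ennreal (descent (?t j u)) * indicator A u
        \<le> (if \<forall>i\<in>{1..j}. ?t i u \<in> {y. envelope y \<le> v} then ennreal (descent (?t j u)) else 0)"
      if "j \<in> {1..K}" for j
      using that by (auto simp: A_def indicator_def)
    then have "(\<Sum>j\<in>{1..K}. ennreal (descent (?t j u)) * indicator A u)
      \<le> (\<Sum>j\<in>{1..K}. if \<forall>i\<in>{1..j}. ?t i u \<in> {y. envelope y \<le> v} then ennreal (descent (?t j u)) else 0)"
      by (rule sum_mono)
    then show "(\<Sum>j\<in>{1..K}. ennreal (descent (?t j u)) * indicator A u)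
      \<le> (if \<forall>j\<in>{1..Suc K}. ?t j u \<in> {y. envelope y \<le> v} then 0 else ennreal (v - m))
        + (\<Sum>j\<in>{1..K}. if \<forall>i\<in>{1..j}. ?t i u \<in> {y. envelope y \<le> v} then ennreal (descent (?t j u)) else 0)"
      by (rule add_increasing[rotated]) simp
  qed
  finally show "(\<Sum>j\<in>{1..K}. \<integral>\<^sup>+w. ennreal (descent (x j w)) * indicator E w \<partial>M) \<le> ?b" .
qed

end

section \<open>The convergence theorem\<close>

text \<open>Along a convergent sequence in the domain the Lipschitz bound keeps \<omega> bounded,
  whereas lower semicontinuity at a limit of value \<infinity> would force it to exceed every
  bound.\<close>

lemma closed_edom:
  fixes \<omega> :: "'a::real_normed_vector \<Rightarrow> ereal"
  assumes fin: "\<forall>y. \<omega> y \<noteq> -\<infinity>" and lsc: "lower_semicontinuous \<omega>"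
    and lip: "lipschitz_on L (edom \<omega>) (\<lambda>y. real_of_ereal (\<omega> y))"
  shows "closed (edom \<omega>)"
  unfolding closed_sequential_limits
proof (intro allI impI, elim conjE)
  fix y l assume y: "\<forall>n. y n \<in> edom \<omega>" "y \<longlonglongrightarrow> l"
  show "l \<in> edom \<omega>"
  proof (rule ccontr)
    assume l: "l \<notin> edom \<omega>"
    obtain C where C: "\<And>n. norm (y n) \<le> C"
      using convergent_imp_Bseq[of y] y(2) by (auto simp: convergent_def Bseq_def)
    define c where "c = real_of_ereal (\<omega> (y 0)) + L * (2 * C)"
    have \<omega>_le: "\<omega> (y n) \<le> ereal c" for n
    proof -
      have L: "0 \<le> L" using lip by (simp add: lipschitz_on_def)
      have "dist (y n) (y 0) \<le> 2 * C"
        using C[of n] C[of 0] norm_triangle_ineq4[of "y n" "y 0"] by (simp add: dist_norm)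
      then have "L * dist (y n) (y 0) \<le> L * (2 * C)" using L by (rule mult_left_mono)
      moreover have "dist (real_of_ereal (\<omega> (y n))) (real_of_ereal (\<omega> (y 0))) \<le> L * dist (y n) (y 0)"
        using lip y(1) by (auto simp: lipschitz_on_def)
      ultimately have "real_of_ereal (\<omega> (y n)) \<le> c"
        by (auto simp: c_def dist_real_def)
      moreover have "\<omega> (y n) = ereal (real_of_ereal (\<omega> (y n)))"
        using y(1) fin by (intro ereal_real'[symmetric]) (auto simp: edom_def)
      ultimately show ?thesis by (metis ereal_less_eq(3))
    qed
    have "\<omega> l = \<infinity>" using l by (auto simp: edom_def)
    then have "ereal c < Liminf (at l) \<omega>"
      using lsc[unfolded lower_semicontinuous_def, rule_format, of l] by simp
    then have "\<forall>\<^sub>F z in at l. ereal c < \<omega> z" by (rule less_LiminfD)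
    \<comment> \<open>The sequence never hits \<open>l\<close>, which lies outside the domain, so
      the punctured filter \<open>at l\<close> applies.\<close>
    moreover have "filterlim y (at l) sequentially"
      using y l by (auto simp: filterlim_at intro!: always_eventually)
    ultimately have "\<forall>\<^sub>F n in sequentially. ereal c < \<omega> (y n)"
      by (auto simp: filterlim_iff)
    then obtain n where "ereal c < \<omega> (y n)" using eventually_happens by force
    then show False using \<omega>_le[of n] by simp
  qed
qed

lemma MIN_le_average_ennreal:
  fixes I :: "nat \<Rightarrow> ennreal" and b :: real
  assumes "1 \<le> K" "0 \<le> b" and le: "(\<Sum>j\<in>{1..K}. I j) \<le> ennreal b"
  shows "(MIN j\<in>{1..K}. I j) \<le> ennreal (b / real K)"
proof -
  define \<mu> where "\<mu> = (MIN j\<in>{1..K}. I j)"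
  have "of_nat (card {1..K}) * \<mu> \<le> (\<Sum>j\<in>{1..K}. I j)"
    unfolding \<mu>_def by (intro sum_bounded_below) simp
  with le have le': "of_nat K * \<mu> \<le> ennreal b" by simp
  show ?thesis
    unfolding \<mu>_def[symmetric]
  proof (cases \<mu>)
    case (real r)
    then have "real K * r \<le> b"
      using le' assms by (simp add: ennreal_of_nat_eq_real_of_nat ennreal_mult[symmetric])
    then show "\<mu> \<le> ennreal (b / real K)"
      using real assms by (simp add: field_simps ennreal_leI)
  next
    case top
    then show "\<mu> \<le> ennreal (b / real K)"
      using le' assms by (simp add: ennreal_mult_top top_unique)
  qed
qed

text \<open>Off the domain the objective is \<infinity>, so the infimum is decided on the domain,
  where the proximal point attains it.\<close>

lemma moreau_envelope_eq:
  fixes \<omega> :: "'a::euclidean_space \<Rightarrow> ereal"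
  assumes "weakly_convex_model \<Xi> (edom \<omega>) f (\<lambda>y. real_of_ereal (\<omega> y)) model Lip G L\<^sub>f L\<^sub>\<omega> \<kappa> \<tau> \<rho> m"
    and fin: "\<forall>y. \<omega> y \<noteq> -\<infinity>"
  shows "moreau_envelope \<rho> (\<lambda>y. ereal (f y) + \<omega> y) c
    = ereal (weakly_convex_model.envelope (edom \<omega>) f (\<lambda>y. real_of_ereal (\<omega> y)) \<rho> c)"
proof -
  interpret weakly_convex_model \<Xi> "edom \<omega>" f "\<lambda>y. real_of_ereal (\<omega> y)" model Lip G L\<^sub>f L\<^sub>\<omega> \<kappa> \<tau> \<rho> m
    by fact
  have obj: "ereal (f z) + \<omega> z + ereal (\<rho> / 2 * (norm (z - c))\<^sup>2) = ereal (prox_objective c z)"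
    if "z \<in> edom \<omega>" for z
    using that fin by (cases "\<omega> z") (auto simp: prox_objective_def edom_def)
  show ?thesis
    unfolding moreau_envelope_def
  proof (rule antisym)
    show "(INF z. ereal (f z) + \<omega> z + ereal (\<rho> / 2 * (norm (z - c))\<^sup>2)) \<le> ereal (envelope c)"
      using INF_lower[of "proximal_point c" UNIV "\<lambda>z. ereal (f z) + \<omega> z + ereal (\<rho> / 2 * (norm (z - c))\<^sup>2)"]
      unfolding obj[OF proximal_point_in] envelope_def by simp
    show "ereal (envelope c) \<le> (INF z. ereal (f z) + \<omega> z + ereal (\<rho> / 2 * (norm (z - c))\<^sup>2))"
    proof (rule INF_greatest)
      fix z
      show "ereal (envelope c) \<le> ereal (f z) + \<omega> z + ereal (\<rho> / 2 * (norm (z - c))\<^sup>2)"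
      proof (cases "z \<in> edom \<omega>")
        case True
        then show ?thesis using proximal_point_le[OF True, of c] unfolding obj[OF True] by simp
      qed (simp add: edom_def)
    qed
  qed
qed

theorem theorem4p2:
  fixes M :: "'w measure" and \<Xi> :: "'s measure"
    and \<xi> :: "nat \<Rightarrow> 'w \<Rightarrow> 's"
    and F :: "real ^ 'n::finite \<Rightarrow> 's \<Rightarrow> real"
    and f :: "real ^ 'n \<Rightarrow> real"
    and \<omega> \<psi> \<psi>env :: "real ^ 'n \<Rightarrow> ereal"
    and model :: "real ^ 'n \<Rightarrow> real ^ 'n \<Rightarrow> 's \<Rightarrow> real"
    and x1 :: "real ^ 'n" and x :: "nat \<Rightarrow> 'w \<Rightarrow> real ^ 'n"
    and Lip :: "'s \<Rightarrow> real" and G :: "real \<Rightarrow> real"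
    and L\<^sub>f L\<^sub>\<omega> \<kappa> \<tau> \<rho> \<alpha> \<Lambda> \<Delta> D \<delta> p R G\<^sub>\<delta> :: real
    and B :: "real \<Rightarrow> real" and K :: nat
  assumes "prob_space M" and "prob_space \<Xi>"
    and iid: "prob_space.indep_vars M (\<lambda>_. \<Xi>) \<xi> {1..K}"
      "\<forall>k\<in>{1..K}. distr M \<Xi> (\<xi> k) = \<Xi>"
    and f: "\<forall>y. integrable \<Xi> (F y)" "\<forall>y. f y = (\<integral>s. F y s \<partial>\<Xi>)"
      "\<forall>s\<in>space \<Xi>. continuous_on UNIV (\<lambda>y. F y s) \<and> (\<exists>l. weakly_convex l (\<lambda>y. ereal (F y s)))"
    and \<omega>: "\<forall>y. \<omega> y \<noteq> -\<infinity>" "lower_semicontinuous \<omega>" "weakly_convex \<kappa> \<omega>"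
      "lipschitz_on L\<^sub>\<omega> (edom \<omega>) (\<lambda>y. real_of_ereal (\<omega> y))"
    and \<psi>: "\<psi> = (\<lambda>y. ereal (f y) + \<omega> y)"
    and model_measurable: "\<forall>y. (\<lambda>(c, s). model c y s) \<in> borel_measurable (borel \<Otimes>\<^sub>M \<Xi>)"
    and M: "0 \<le> \<tau>" "model_accuracy \<Xi> (edom \<omega>) f model \<tau>"
    and G: "generalized_lipschitz \<Xi> model Lip L\<^sub>f G"
    and envelope: "\<psi>env = moreau_envelope \<rho> \<psi>"
    and lower_bound: "0 \<le> \<Lambda>" "\<forall>y. ereal (- \<Lambda>) \<le> \<psi>env y"
    and level_sets: "\<forall>v. bounded (level_set \<psi>env v) \<and> diameter (level_set \<psi>env v) \<le> B v"
    and parameters: "\<rho> > \<kappa> + \<tau>" "\<alpha> > 0" "K \<ge> 1"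
    and run: "x1 \<in> edom \<omega>"
      "model_based_run M \<xi> model \<omega>
         (\<lambda>c. \<rho> + \<kappa> + \<tau> + \<alpha> * (G (norm c) + 1) * sqrt (real K)) K x1 x"
    and \<Delta>: "\<Delta> = real_of_ereal (\<psi>env x1) + \<Lambda> + \<rho> * (L\<^sub>f + L\<^sub>\<omega>)\<^sup>2 / \<alpha>\<^sup>2" "\<Delta> > 0"
    and D: "D = real_of_ereal (\<psi> x1) - real_of_ereal (INF y. \<psi> y)"
    and \<delta>_p: "\<delta> \<in> {0<..<1/4}" "p \<in> {2 * \<delta><..<1}"
    \<comment> \<open>Choice of origin: a bound on the diameter of the level set locates it relative to 0
        only if 0 belongs to it.\<close>
    and origin: "0 \<in> level_set \<psi>env (\<Delta> / \<delta>)"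
    and R: "R = B (\<Delta> / \<delta>) + 4 * (L\<^sub>f + L\<^sub>\<omega>) / (\<alpha> * sqrt (real K))"
    and G\<^sub>\<delta>: "G\<^sub>\<delta> = (SUP z\<in>{0..R}. G z)"
  \<comment> \<open>The expectation is over the runs in the event \<open>E\<close>: \<open>uniform_measure M E\<close> is \<open>M\<close>
      conditioned on \<open>E\<close>.\<close>
  shows "\<exists>E\<in>sets M. measure M E \<ge> 1 - p \<and>
     (\<forall>w\<in>E. real (card {k\<in>{1..K}. x k w \<in> cball 0 R}) \<ge> (1 - 2 * \<delta> / p) * real K) \<and>
     (MIN k\<in>{1..K}. \<integral>\<^sup>+ w. ennreal ((norm (gradient (\<lambda>y. real_of_ereal (\<psi>env y)) (x k w)))\<^sup>2)
                          \<partial>uniform_measure M E)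
       \<le> ennreal (p / (p - 2 * \<delta>) * (2 * \<rho> / (\<rho> - \<tau> - \<kappa>))
           * (D + \<rho> / (2 * \<alpha>\<^sup>2) * (L\<^sub>f + L\<^sub>\<omega>)\<^sup>2)
           * ((\<rho> + \<tau> + \<kappa>) / real K + \<alpha> * (G\<^sub>\<delta> + 1) / sqrt (real K)))"
proof -

  \<comment> \<open>Reduction to real-valued functions on the domain\<close>
  define X where "X = edom \<omega>"
  define \<omega>r where "\<omega>r y = real_of_ereal (\<omega> y)" for y
  define \<gamma> where "\<gamma> c = \<rho> + \<kappa> + \<tau> + \<alpha> * (G (norm c) + 1) * sqrt (real K)" for c :: "real ^ 'n"
  interpret M: prob_space M by fact
  have \<omega>_eq: "\<omega> y = ereal (\<omega>r y)" if "y \<in> X" for y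
    using that \<omega>(1) by (cases "\<omega> y") (auto simp: X_def edom_def \<omega>r_def)
  have \<omega>_top: "\<omega> y = \<infinity>" if "y \<notin> X" for y
    using that by (simp add: X_def edom_def)
  have \<psi>_X: "\<psi> y = ereal (f y + \<omega>r y)" if "y \<in> X" for y
    using \<omega>_eq[OF that] by (simp add: \<psi>)
  have x1: "x1 \<in> X" using run(1) by (simp add: X_def)
  have \<kappa>: "0 \<le> \<kappa>" using \<omega>(3) by (simp add: weakly_convex_def)
  have \<rho>_pos: "0 < \<rho>" using \<kappa> M(1) parameters(1) by simp
  \<comment> \<open>Testing the infimum at \<open>y\<close> itself puts the envelope below \<psi>,
    which passes the lower bound on to \<psi>.\<close>
  have \<Lambda>_le: "ereal (- \<Lambda>) \<le> \<psi> y" for y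
  proof -
    have "\<psi>env y \<le> \<psi> y + ereal (\<rho> / 2 * (norm (y - y))\<^sup>2)"
      unfolding envelope moreau_envelope_def by (rule INF_lower) simp
    then show ?thesis using lower_bound(2)[rule_format, of y] by (simp add: zero_ereal_def[symmetric])
  qed
  \<comment> \<open>The infimum lies between minus \<Lambda> and the finite value at
    \<open>x1\<close>, so \<open>real_of_ereal\<close> in \<open>D\<close> does not return its
    default 0.\<close>
  define \<psi>inf where "\<psi>inf = real_of_ereal (INF y. \<psi> y)"
  have \<psi>inf: "(INF y. \<psi> y) = ereal \<psi>inf"
  proof -
    have "ereal (- \<Lambda>) \<le> (INF y. \<psi> y)" by (intro INF_greatest \<Lambda>_le)
    moreover have "(INF y. \<psi> y) \<le> ereal (f x1 + \<omega>r x1)"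
      unfolding \<psi>_X[OF x1, symmetric] by (rule INF_lower) simp
    ultimately show ?thesis unfolding \<psi>inf_def by (cases "INF y. \<psi> y") auto
  qed
  have base: "weakly_convex_model \<Xi> X f \<omega>r model Lip G L\<^sub>f L\<^sub>\<omega> \<kappa> \<tau> \<rho> m"
    if m: "\<And>y. y \<in> X \<Longrightarrow> m \<le> f y + \<omega>r y" for m
  proof (intro weakly_convex_model.intro weakly_convex_model_axioms.intro)
    show "closed X" unfolding X_def by (rule closed_edom[OF \<omega>(1,2,4)])
    show "convex_on X (\<lambda>y. \<omega>r y + \<kappa> / 2 * (norm y)\<^sup>2)"
      using \<omega>(3) by (simp add: weakly_convex_def X_def \<omega>r_def)
    show "lipschitz_on L\<^sub>\<omega> X \<omega>r" using \<omega>(4) by (simp add: X_def \<omega>r_def[abs_def])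
    show "model_accuracy \<Xi> X f model \<tau>" using M(2) by (simp add: X_def)
  qed (use assms(2) x1 \<kappa> M(1) G parameters m in auto)
  have "continuous_on {0..} G" using G by (simp add: generalized_lipschitz_def)
  then have "continuous_on UNIV (\<lambda>c::real ^ 'n. G (norm c))"
    by (rule continuous_on_compose2) (auto intro: continuous_on_norm continuous_on_id)
  then have \<gamma>_meas: "\<gamma> \<in> borel_measurable borel"
    unfolding \<gamma>_def[abs_def] by (intro borel_measurable_continuous_onI continuous_intros)
  have G_nonneg: "0 \<le> G z" if "0 \<le> z" for z
    using G that by (simp add: generalized_lipschitz_def)
  have \<gamma>_ge: "\<kappa> + \<alpha> * (G (norm c) + 1) * sqrt (real K) \<le> \<gamma> c" for c
    using \<rho>_pos M(1) by (simp add: \<gamma>_def)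
  have \<gamma>_gt: "\<kappa> < \<gamma> c" for c
    using \<rho>_pos M(1) parameters G_nonneg[of "norm c"] by (simp add: \<gamma>_def add_pos_nonneg)
  have full: "stochastic_model \<Xi> X f \<omega>r model Lip G L\<^sub>f L\<^sub>\<omega> \<kappa> \<tau> \<rho> m \<gamma>"
    if "\<And>y. y \<in> X \<Longrightarrow> m \<le> f y + \<omega>r y" for m
    using base[OF that] model_measurable \<gamma>_meas \<gamma>_gt
    by (auto intro!: stochastic_model.intro stochastic_model_axioms.intro)
  \<comment> \<open>Two instances that differ only in the lower bound. Envelope, step and descent do
    not depend on it, so facts from \<open>A\<close> and \<open>I\<close> speak of the same
    objects.\<close>
  interpret A: stochastic_model \<Xi> X f \<omega>r model Lip G L\<^sub>f L\<^sub>\<omega> \<kappa> \<tau> \<rho> "- \<Lambda>" \<gamma>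
    using \<Lambda>_le \<psi>_X by (intro full) (metis ereal_less_eq(3))
  interpret I: stochastic_model \<Xi> X f \<omega>r model Lip G L\<^sub>f L\<^sub>\<omega> \<kappa> \<tau> \<rho> \<psi>inf \<gamma>
  proof (rule full)
    fix y assume "y \<in> X"
    have "(INF y. \<psi> y) \<le> \<psi> y" by (rule INF_lower) simp
    then show "\<psi>inf \<le> f y + \<omega>r y" using \<psi>_X[OF \<open>y \<in> X\<close>] \<psi>inf by simp
  qed
  have env_eq: "\<psi>env y = ereal (A.envelope y)" for y
    unfolding envelope \<psi> X_def \<omega>r_def[abs_def]
    by (rule moreau_envelope_eq[OF A.weakly_convex_model_axioms[unfolded X_def \<omega>r_def[abs_def]] \<omega>(1)])
  have grad: "gradient (\<lambda>y. real_of_ereal (\<psi>env y)) c = \<rho> *\<^sub>R (c - A.proximal_point c)" for c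
    using A.gradient_envelope[of c] by (simp add: env_eq)

  \<comment> \<open>The run is the chain generated by \<open>step\<close>\<close>
  have \<xi>_space: "\<xi> k w \<in> space \<Xi>" if "k \<in> {1..K}" "w \<in> space M" for k w
    using iid(1) that by (auto simp: M.indep_vars_def dest: measurable_space)
  \<comment> \<open>The minimum over the whole space is finite, as the value at \<open>x1\<close>
    shows, so it is attained in \<open>X\<close>; there uniqueness applies.\<close>
  have iterate: "x (Suc k) w = A.step (x k w) (\<xi> k w) \<and> x (Suc k) w \<in> X"
    if w: "w \<in> space M" and k: "k \<in> {1..K}" and xk: "x k w \<in> X" for w k
  proof -
    define \<Phi> where "\<Phi> y = ereal (model (x k w) y (\<xi> k w)) + \<omega> y
      + ereal (\<gamma> (x k w) / 2 * (norm (y - x k w))\<^sup>2)" for y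
    have "is_arg_min \<Phi> (\<lambda>_. True) (x (Suc k) w)"
      using run(2) w k unfolding model_based_run_def \<Phi>_def[abs_def] \<gamma>_def by blast
    then have min: "\<Phi> (x (Suc k) w) \<le> \<Phi> y" for y
      by (auto simp: is_arg_min_def not_less)
    have \<Phi>_X: "\<Phi> y = ereal (A.step_objective (x k w) (\<xi> k w) y)" if "y \<in> X" for y
      using \<omega>_eq[OF that] by (simp add: \<Phi>_def A.step_objective_def)
    have "x (Suc k) w \<in> X"
    proof (rule ccontr)
      assume "x (Suc k) w \<notin> X"
      then have "\<Phi> (x (Suc k) w) = \<infinity>" by (simp add: \<Phi>_def \<omega>_top)
      then show False using min[of x1] \<Phi>_X[OF x1] by simp
    qed
    moreover from this have "x (Suc k) w = A.step (x k w) (\<xi> k w)"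
      using xk \<xi>_space[OF k w] min \<Phi>_X by (intro A.step_unique) (auto, metis ereal_less_eq(3))
    ultimately show ?thesis by blast
  qed
  have x_1: "x 1 w = x1" if "w \<in> space M" for w
    using run(2) that by (simp add: model_based_run_def)
  have xX: "x k w \<in> X" if w: "w \<in> space M" and "1 \<le> k" "k \<le> Suc K" for k w
    using that(2,3)
  proof (induction k rule: dec_induct)
    case base
    then show ?case using x_1[OF w] x1 by simp
  next
    case (step k)
    then show ?case using iterate[OF w, of k] by auto
  qed
  have x_Suc: "x (Suc k) w = A.step (x k w) (\<xi> k w)" if "w \<in> space M" "k \<in> {1..K}" for w k
    using iterate[OF that xX[OF that(1)]] that by auto

  \<comment> \<open>The event that the run stays in the level set\<close>
  define v where "v = \<Delta> / \<delta>"
  define \<epsilon> where "\<epsilon> = \<rho> * (L\<^sub>f + L\<^sub>\<omega>)\<^sup>2 / (2 * \<alpha>\<^sup>2)"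
  define E where "E = {w \<in> space M. \<forall>j\<in>{1..Suc K}. A.envelope (x j w) \<le> v}"
  have distr: "\<And>k. k \<in> {1..K} \<Longrightarrow> distr M \<Xi> (\<xi> k) = \<Xi>" using iid(2) by blast
  note run_facts = parameters(2,3) \<gamma>_ge x1 assms(1) iid(1) distr x_1 x_Suc
  have x_meas: "\<And>j. j \<in> {1..Suc K} \<Longrightarrow> x j \<in> borel_measurable M"
    by (rule A.run_bounds(1)[OF run_facts])
  have E: "E \<in> sets M"
    unfolding E_def by (rule A.run_bounds(2)[OF run_facts])
  have exit_bound: "ennreal (v - - \<Lambda>) * emeasure M (space M - E) \<le> ennreal (A.envelope x1 - - \<Lambda> + \<epsilon>)"
    unfolding E_def \<epsilon>_def by (rule A.run_bounds(3)[OF run_facts])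
  have descent_bound: "(\<Sum>j\<in>{1..K}. \<integral>\<^sup>+w. ennreal (A.descent (x j w)) * indicator E w \<partial>M)
      \<le> ennreal (A.envelope x1 - \<psi>inf + \<epsilon>)"
    unfolding E_def \<epsilon>_def by (rule I.run_bounds(4)[OF run_facts])
  have \<epsilon>: "0 \<le> \<epsilon>" using \<rho>_pos by (simp add: \<epsilon>_def)
  have \<delta>: "0 < \<delta>" "\<delta> < 1 / 4" "2 * \<delta> < p" "p < 1" using \<delta>_p by auto
  \<comment> \<open>\<Delta> is the initial envelope plus \<Lambda> plus twice \<epsilon>, so it
    dominates the exit bound. Since \<Lambda> is nonnegative, \<open>v + \<Lambda>\<close> may be
    lowered to \<open>v = \<Delta> / \<delta>\<close>.\<close>
  have prob_E: "1 - \<delta> \<le> measure M E"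
  proof -
    have "A.envelope x1 + \<Lambda> + \<epsilon> \<le> \<Delta>"
      using \<Delta>(1) \<epsilon> env_eq[of x1] by (simp add: \<epsilon>_def)
    moreover have "ennreal ((v + \<Lambda>) * measure M (space M - E)) \<le> ennreal (A.envelope x1 + \<Lambda> + \<epsilon>)"
      using exit_bound lower_bound(1) \<Delta>(2) \<delta>(1)
      by (simp add: M.emeasure_eq_measure v_def ennreal_mult)
    moreover have "0 \<le> A.envelope x1 + \<Lambda> + \<epsilon>"
      using A.envelope_ge[of x1] \<epsilon> by simp
    ultimately have "(v + \<Lambda>) * measure M (space M - E) \<le> \<Delta>" by simp
    moreover have "v * measure M (space M - E) \<le> (v + \<Lambda>) * measure M (space M - E)"
      using lower_bound(1) by (intro mult_right_mono) auto
    ultimately have "\<Delta> * measure M (space M - E) \<le> \<Delta> * \<delta>"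
      using \<delta>(1) by (simp add: v_def field_simps)
    then have "measure M (space M - E) \<le> \<delta>" using \<Delta>(2) by (simp add: mult_le_cancel_left)
    then show ?thesis using M.prob_compl[OF E] by simp
  qed
  have R_ge: "B v \<le> R"
    using A.L\<^sub>f_nonneg A.L\<^sub>\<omega>_nonneg parameters(2) by (simp add: R v_def)
  have norm_le: "norm (x j w) \<le> R" if "w \<in> E" "j \<in> {1..Suc K}" for j w
  proof -
    have "x j w \<in> level_set \<psi>env v" using that by (simp add: E_def level_set_def env_eq)
    moreover have "0 \<in> level_set \<psi>env v" using origin by (simp add: v_def)
    ultimately have "dist 0 (x j w) \<le> diameter (level_set \<psi>env v)"
      using level_sets by (intro diameter_bounded_bound) auto
    then show ?thesis using level_sets[rule_format, of v] R_ge by simp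
  qed
  \<comment> \<open>The event has positive probability, hence contains a run, and the norm of an
    iterate bounds \<open>R\<close> from below. This puts 0 into \<open>{0..R}\<close>, which yields
    \<open>G\<^sub>\<delta>_nonneg\<close>.\<close>
  have R_nonneg: "0 \<le> R"
  proof -
    have "E \<noteq> {}" using prob_E \<delta> by auto
    then obtain w where "w \<in> E" by auto
    then have "norm (x 1 w) \<le> R" by (rule norm_le) simp
    then show ?thesis by (rule order_trans[OF norm_ge_zero])
  qed
  have G_le: "G z \<le> G\<^sub>\<delta>" if "0 \<le> z" "z \<le> R" for z
    unfolding G\<^sub>\<delta>
  proof (rule cSUP_upper)
    show "bdd_above (G ` {0..R})" using A.G_mono by (intro bdd_aboveI2[where M = "G R"]) auto
  qed (use that in simp)

  \<comment> \<open>Gradients on the event\<close>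
  define \<gamma>\<^sub>\<delta> where "\<gamma>\<^sub>\<delta> = \<rho> + \<tau> + \<kappa> + \<alpha> * (G\<^sub>\<delta> + 1) * sqrt (real K)"
  \<comment> \<open>Inverts the coefficient in \<open>descent\<close>, with
    \<open>\<gamma> c - \<kappa>\<close> replaced by its upper bound
    \<open>\<gamma>\<^sub>\<delta>\<close> on the event.\<close>
  define C where "C = \<rho> / (\<rho> - \<tau> - \<kappa>) * \<gamma>\<^sub>\<delta>"
  have gap: "0 < \<rho> - \<tau> - \<kappa>" using parameters(1) by simp
  have G\<^sub>\<delta>_nonneg: "0 \<le> G\<^sub>\<delta>" using G_le[of 0] R_nonneg G_nonneg[of 0] by simp
  have C: "0 \<le> C"
    unfolding C_def \<gamma>\<^sub>\<delta>_def using \<rho>_pos gap G\<^sub>\<delta>_nonneg parameters \<kappa> M(1) by (intro mult_nonneg_nonneg) auto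
  let ?g = "\<lambda>j w. (norm (gradient (\<lambda>y. real_of_ereal (\<psi>env y)) (x j w)))\<^sup>2"
  have grad_le: "?g j w \<le> C * A.descent (x j w)" if "w \<in> E" "j \<in> {1..Suc K}" for j w
  proof -
    let ?c = "x j w"
    let ?d = "(norm (A.proximal_point ?c - ?c))\<^sup>2"
    have "G (norm ?c) \<le> G\<^sub>\<delta>" using G_le norm_le[OF that] by simp
    then have "\<alpha> * (G (norm ?c) + 1) * sqrt (real K) \<le> \<alpha> * (G\<^sub>\<delta> + 1) * sqrt (real K)"
      using parameters by (intro mult_right_mono mult_left_mono) auto
    then have "\<gamma> ?c - \<kappa> \<le> \<gamma>\<^sub>\<delta>" using \<kappa> by (simp add: \<gamma>_def \<gamma>\<^sub>\<delta>_def)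
    moreover have pos: "0 < \<gamma> ?c - \<kappa>" using \<gamma>_gt by simp
    ultimately have "1 \<le> \<gamma>\<^sub>\<delta> / (\<gamma> ?c - \<kappa>)" by (simp add: field_simps)
    then have "\<rho>\<^sup>2 * ?d * 1 \<le> \<rho>\<^sup>2 * ?d * (\<gamma>\<^sub>\<delta> / (\<gamma> ?c - \<kappa>))" by (intro mult_left_mono) auto
    also have "\<dots> = C * A.descent ?c"
      using gap by (simp add: C_def A.descent_def power2_eq_square)
    finally show ?thesis
      using \<rho>_pos by (simp add: grad power_mult_distrib norm_minus_commute)
  qed
  have D_eq: "D = f x1 + \<omega>r x1 - \<psi>inf" using D \<psi>_X[OF x1] by (simp add: \<psi>inf_def)
  have D_nonneg: "0 \<le> D" using I.lower[OF x1] by (simp add: D_eq)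
  let ?P = "measure M E"
  \<comment> \<open>Conditioning divides by this probability, so it costs at most the factor 2 that
    appears in \<open>2 * \<rho> / (\<rho> - \<tau> - \<kappa>)\<close>.\<close>
  have P: "1 / 2 \<le> ?P" using prob_E \<delta> by simp
  let ?I = "\<lambda>j. \<integral>\<^sup>+ w. ennreal (?g j w) \<partial>uniform_measure M E"
  have I_le: "?I j \<le> ennreal (2 * C) * (\<integral>\<^sup>+w. ennreal (A.descent (x j w)) * indicator E w \<partial>M)"
    if j: "j \<in> {1..K}" for j
  proof -
    have j': "j \<in> {1..Suc K}" using j by auto
    note [measurable] = x_meas[OF j'] A.proximal_point_measurable A.descent_measurable E
    have "?I j = (\<integral>\<^sup>+w. ennreal (?g j w) * indicator E w \<partial>M) / emeasure M E"
      using E unfolding grad by (intro nn_integral_uniform_measure) measurable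
    also have "\<dots> \<le> (\<integral>\<^sup>+w. ennreal C * (ennreal (A.descent (x j w)) * indicator E w) \<partial>M) / emeasure M E"
    proof (intro divide_right_mono_ennreal nn_integral_mono)
      fix w
      show "ennreal (?g j w) * indicator E w \<le> ennreal C * (ennreal (A.descent (x j w)) * indicator E w)"
        using grad_le[OF _ j', of w] C by (auto simp: indicator_def ennreal_mult'[symmetric] intro!: ennreal_leI)
    qed
    also have "\<dots> = ennreal C * (\<integral>\<^sup>+w. ennreal (A.descent (x j w)) * indicator E w \<partial>M) / emeasure M E"
    proof -
      have "(\<lambda>w. ennreal (A.descent (x j w)) * indicator E w) \<in> borel_measurable M" by measurable
      then show ?thesis by (simp add: nn_integral_cmult)
    qed
    also have "\<dots> = ennreal C * inverse (emeasure M E) * (\<integral>\<^sup>+w. ennreal (A.descent (x j w)) * indicator E w \<partial>M)"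
      by (simp add: divide_ennreal_def mult_ac)
    also have "\<dots> \<le> ennreal (2 * C) * (\<integral>\<^sup>+w. ennreal (A.descent (x j w)) * indicator E w \<partial>M)"
    proof (rule mult_right_mono)
      have "inverse (emeasure M E) = ennreal (inverse ?P)"
        using P by (simp add: M.emeasure_eq_measure inverse_ennreal)
      moreover have "C * inverse ?P \<le> C * 2"
        using P C by (intro mult_left_mono) (auto simp: field_simps)
      ultimately show "ennreal C * inverse (emeasure M E) \<le> ennreal (2 * C)"
        using C P by (simp add: ennreal_mult[symmetric] ennreal_leI mult.commute)
    qed simp
    finally show ?thesis .
  qed

  \<comment> \<open>Summation over the iterates and the final constants\<close>
  have "(\<Sum>j\<in>{1..K}. ?I j) \<le> (\<Sum>j\<in>{1..K}. ennreal (2 * C) * (\<integral>\<^sup>+w. ennreal (A.descent (x j w)) * indicator E w \<partial>M))"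
    by (intro sum_mono I_le)
  also have "\<dots> \<le> ennreal (2 * C) * ennreal (A.envelope x1 - \<psi>inf + \<epsilon>)"
    unfolding sum_distrib_left[symmetric] by (rule mult_left_mono[OF descent_bound]) simp
  \<comment> \<open>The envelope lies below \<psi> at \<open>x1\<close>, which brings in
    \<open>D\<close>.\<close>
  also have "\<dots> \<le> ennreal (2 * C) * ennreal (D + \<epsilon>)"
    using A.envelope_le[OF x1] by (intro mult_left_mono ennreal_leI) (auto simp: D_eq)
  also have "\<dots> = ennreal (2 * C * (D + \<epsilon>))"
    using C D_nonneg \<epsilon> by (intro ennreal_mult[symmetric]) auto
  finally have "(MIN j\<in>{1..K}. ?I j) \<le> ennreal (2 * C * (D + \<epsilon>) / real K)"
    using C D_nonneg \<epsilon> parameters(3) by (intro MIN_le_average_ennreal) auto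
  also have "\<dots> \<le> ennreal (p / (p - 2 * \<delta>) * (2 * \<rho> / (\<rho> - \<tau> - \<kappa>))
           * (D + \<rho> / (2 * \<alpha>\<^sup>2) * (L\<^sub>f + L\<^sub>\<omega>)\<^sup>2)
           * ((\<rho> + \<tau> + \<kappa>) / real K + \<alpha> * (G\<^sub>\<delta> + 1) / sqrt (real K)))"
  proof (rule ennreal_leI)
    have sq: "sqrt (real K) / real K = 1 / sqrt (real K)"
      using parameters(3) by (simp add: field_simps)
    have "\<gamma>\<^sub>\<delta> / real K = (\<rho> + \<tau> + \<kappa>) / real K + \<alpha> * (G\<^sub>\<delta> + 1) * (sqrt (real K) / real K)"
      by (simp add: \<gamma>\<^sub>\<delta>_def add_divide_distrib)
    then have \<gamma>K: "(\<rho> + \<tau> + \<kappa>) / real K + \<alpha> * (G\<^sub>\<delta> + 1) / sqrt (real K) = \<gamma>\<^sub>\<delta> / real K"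
      unfolding sq by simp
    \<comment> \<open>Multiplying by a factor of at least 1 enlarges the nonnegative bound to the
      stated form.\<close>
    have "1 \<le> p / (p - 2 * \<delta>)" using \<delta> by (simp add: field_simps)
    then have "1 * (2 * C * (D + \<epsilon>) / real K) \<le> p / (p - 2 * \<delta>) * (2 * C * (D + \<epsilon>) / real K)"
      using C D_nonneg \<epsilon> by (intro mult_right_mono) auto
    then show "2 * C * (D + \<epsilon>) / real K \<le> p / (p - 2 * \<delta>) * (2 * \<rho> / (\<rho> - \<tau> - \<kappa>))
           * (D + \<rho> / (2 * \<alpha>\<^sup>2) * (L\<^sub>f + L\<^sub>\<omega>)\<^sup>2)
           * ((\<rho> + \<tau> + \<kappa>) / real K + \<alpha> * (G\<^sub>\<delta> + 1) / sqrt (real K))"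
      unfolding \<gamma>K by (simp add: C_def \<epsilon>_def mult_ac)
  qed
  finally have min_le: "(MIN j\<in>{1..K}. ?I j) \<le> \<dots>" .
  show ?thesis
  proof (intro bexI[OF _ E] conjI ballI)
    show "1 - p \<le> measure M E" using prob_E \<delta> by simp
    fix w assume w: "w \<in> E"
    \<comment> \<open>On the event all \<open>K\<close> iterates lie in the ball, and the required
      fraction is at most 1.\<close>
    then have "{k\<in>{1..K}. x k w \<in> cball 0 R} = {1..K}" using norm_le[OF w] by auto
    moreover have "(1 - 2 * \<delta> / p) * real K \<le> 1 * real K"
      using \<delta> by (intro mult_right_mono) auto
    ultimately show "(1 - 2 * \<delta> / p) * real K \<le> real (card {k\<in>{1..K}. x k w \<in> cball 0 R})" by simp
  qed (rule min_le)
qed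

end
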